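(* Let $\Bbbk$ be a commutative ring, let $\mathcal{P}=\bigoplus_{n\ge0}\Bbbk P_n$ be the graded Hopf algebra of uniform block permutations, and let $\mathcal{P}^*=\bigoplus_{n\ge0}(\Bbbk P_n)^*$ be its graded dual, with $\{f^*\mid f\in P_n\}$ the basis of $(\Bbbk P_n)^*$ dual to the basis $P_n$ of $\Bbbk P_n$. For a uniform block permutation $f:\mathcal{A}\to\mathcal{B}$ let $\tilde{f}:\mathcal{B}\to\mathcal{A}$ denote the inverse bijection. Then the linear map $$\mathcal{P}^*\to\mathcal{P},\qquad f^*\mapsto\tilde{f},$$ is an isomorphism of graded Hopf algebras.
   Context: **Uniform block permutations.** For $n\ge 0$ let $[n]=\{1,\dots,n\}$. A set partition of $[n]$ is a collection of non-empty disjoint subsets (blocks) of $[n]$ with union $[n]$. A uniform block permutation of $[n]$ is a bijection $f:\mathcal{A}\to\mathcal{B}$ between two set partitions of $[n]$ such that $|f(A)|=|A|$ for every $A\in\mathcal{A}$; $\mathcal A$ is its domain and $\mathcal B$ its codomain. $P_n$ is the (finite) set of uniform block permutations of $[n]$; $P_0=\{\emptyset\}$, where $\emptyset$ denotes the empty uniform block permutation. **Monoid structure.** For $f:\mathcal{A}\to\mathcal{B}$ and $g:\mathcal{C}\to\mathcal{D}$ in $P_n$, the product $g\cdot f$ ("first $f$, then $g$") is defined as follows: let $\mathcal{E}$ be the finest set partition of $[n]$ such that every block of $\mathcal{B}$ and every block of $\mathcal{C}$ is contained in a block of $\mathcal{E}$; for each $E\in\mathcal{E}$, $g\cdot f$ has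 the domain block $\bigcup\{f^{-1}(B): B\in\mathcal{B}, B\subseteq E\}$ and sends it to $\bigcup\{g(C): C\in\mathcal{C}, C\subseteq E\}$. A permutation $\sigma\in S_n$ is identified with the uniform block permutation $\{i\}\mapsto\{\sigma(i)\}$; thus $S_n$ is a submonoid of $P_n$. $\Bbbk P_n$ is the monoid algebra (free $\Bbbk$-module on $P_n$, product extended bilinearly). **Concatenation.** For $f\in P_n$, $g\in P_m$, $f\times g\in P_{n+m}$ is the uniform block permutation whose domain blocks are the domain blocks $A$ of $f$, with $A\mapsto f(A)$, and the sets $A'+n=\{a+n: a\in A'\}$ for $A'$ a domain block of $g$, with $A'+n\mapsto g(A')+n$. **The Hopf algebra $\mathcal{P}$.** An $(n,m)$-shuffle is $\xi\in S_{n+m}$ with $\xi(1)<\cdots<\xi(n)$ and $\xi(n+1)<\cdots<\xi(n+m)$. $\mathrm{Sh}(n,m)$ is the set of these and $sh_{n,m}=\sum_{\xi\in \mathrm{Sh}(n,m)}\xi$. The product of $\mathcal{P}$ is $f\ast g=sh_{n,m}\cdot(f\times g)$ for $f\in P_n$, $g\in P_m$, extended bilinearly. A breaking point of a set partition $\mathcal{B}$ of $[n]$ is $i\in\{0,\dots,n\}$ such that $\{1,\dots,i\}$ is a union of blocks of $\mathcal{B}$; for $f:\mathcal{A}\to\mathcal{B}$, $B(f)$ is the set of breaking points of $\mathcal{B}$. For each $i\in B(f)$ there are a unique $\xi\in\mathrm{Sh}(i,n-i)$ and unique $f_{(i)}\in P_i$, $f'_{(n-i)}\in P_{n-i}$ with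 $f=(f_{(i)}\times f'_{(n-i)})\cdot\xi^{-1}$. The coproduct is $\Delta(f)=\sum_{i\in B(f)}f_{(i)}\otimes f'_{(n-i)}$. The unit is $\emptyset$; the counit is $\varepsilon(\emptyset)=1$, $\varepsilon(f)=0$ for $f\in P_n$, $n\ge1$. With the grading in which $\Bbbk P_n$ has degree $n$, this is a graded connected Hopf algebra. **Graded dual.** $\mathcal{P}^*$ carries the dual graded Hopf algebra structure: its product is dual to $\Delta$ and its coproduct is dual to $\ast$. *)

theory Defs
  imports
    "HOL-Library.Disjoint_Sets"
    "HOL-Library.Poly_Mapping"
    "HOL-Library.Function_Algebras"
    "HOL-Combinatorics.Permutations"
begin

section \<open>Uniform block permutations\<close>

text \<open>
  A uniform block permutation \<open>f : \<A> \<rightarrow> \<B>\<close> of \<open>{1..n}\<close> is represented by its graph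
  \<open>{(A, f(A)) | A \<in> \<A>}\<close>, so that \<open>\<A>\<close> and \<open>\<B>\<close> are the \<^const>\<open>Domain\<close> and the
  \<^const>\<open>Range\<close> of the graph and the inverse bijection is the converse relation.
\<close>

definition is_ubp :: "nat \<Rightarrow> (nat set \<times> nat set) set \<Rightarrow> bool" where
  "is_ubp n f \<longleftrightarrow>
     partition_on {1..n} (Domain f) \<and> partition_on {1..n} (Range f) \<and>
     single_valued f \<and> single_valued (f\<inverse>) \<and>
     (\<forall>(A, B)\<in>f. card A = card B)"

lemma is_ubp_empty: "is_ubp 0 {}"
  by (simp add: is_ubp_def partition_on_empty)

text \<open>
  The type \<open>ubp\<close> is the disjoint union of all \<open>P\<^sub>n\<close>. The number \<open>n\<close> is recovered from a
  graph as the number of points covered by its blocks.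
\<close>

typedef ubp = "{f. \<exists>n. is_ubp n f}" morphisms graph Abs_ubp
  using is_ubp_empty by blast

definition degree :: "ubp \<Rightarrow> nat" where
  "degree f = card (\<Union>(Domain (graph f)))"

definition ubp_empty :: ubp where
  "ubp_empty = Abs_ubp {}"

definition ubp_inverse :: "ubp \<Rightarrow> ubp" where
  "ubp_inverse f = Abs_ubp ((graph f)\<inverse>)"

text \<open>The permutation \<open>\<sigma>\<close> of \<open>{1..n}\<close>, viewed as an element of \<open>P\<^sub>n\<close>.\<close>

definition ubp_of_perm :: "nat \<Rightarrow> (nat \<Rightarrow> nat) \<Rightarrow> ubp" where
  "ubp_of_perm n \<sigma> = Abs_ubp ((\<lambda>i. ({i}, {\<sigma> i})) ` {1..n})"

definition concat_graph ::
  "nat \<Rightarrow> (nat set \<times> nat set) set \<Rightarrow> (nat set \<times> nat set) set \<Rightarrow> (nat set \<times> nat set) set" where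
  "concat_graph n f g = f \<union> (\<lambda>(A, B). ((\<lambda>a. a + n) ` A, (\<lambda>a. a + n) ` B)) ` g"

definition ubp_concat :: "ubp \<Rightarrow> ubp \<Rightarrow> ubp" where
  "ubp_concat f g = Abs_ubp (concat_graph (degree f) (graph f) (graph g))"

definition finest_join :: "'a set \<Rightarrow> 'a set set \<Rightarrow> 'a set set \<Rightarrow> 'a set set" where
  "finest_join S \<B> \<C> = (THE \<E>. refines S \<B> \<E> \<and> refines S \<C> \<E> \<and>
     (\<forall>\<E>'. refines S \<B> \<E>' \<and> refines S \<C> \<E>' \<longrightarrow> refines S \<E> \<E>'))"

definition mult_graph ::
  "nat \<Rightarrow> (nat set \<times> nat set) set \<Rightarrow> (nat set \<times> nat set) set \<Rightarrow> (nat set \<times> nat set) set" where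
  "mult_graph n g f =
     (\<lambda>E. (\<Union>{A. \<exists>B. (A, B) \<in> f \<and> B \<subseteq> E}, \<Union>{D. \<exists>C. (C, D) \<in> g \<and> C \<subseteq> E}))
       ` finest_join {1..n} (Range f) (Domain g)"

text \<open>
  \<open>ubp_mult g f\<close> is \<open>g \<cdot> f\<close> (first \<open>f\<close>, then \<open>g\<close>). It is meaningful only if both factors
  have the same degree.
\<close>

definition ubp_mult :: "ubp \<Rightarrow> ubp \<Rightarrow> ubp" where
  "ubp_mult g f = Abs_ubp (mult_graph (degree f) (graph g) (graph f))"

subsection \<open>Well-definedness of the operations\<close>

lemma is_ubp_degree: "is_ubp (degree f) (graph f)"
proof -
  obtain n where n: "is_ubp n (graph f)" using graph[of f] by blast
  then have "\<Union>(Domain (graph f)) = {1..n}" by (auto simp: is_ubp_def partition_on_def)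
  then have "degree f = n" by (simp add: degree_def)
  with n show ?thesis by simp
qed

lemma graph_Abs_ubp:
  assumes "is_ubp n f" shows "graph (Abs_ubp f) = f" "degree (Abs_ubp f) = n"
proof -
  show *: "graph (Abs_ubp f) = f"
    by (rule Abs_ubp_inverse, rule CollectI, rule exI, rule assms)
  have "\<Union>(Domain f) = {1..n}" using assms by (auto simp: is_ubp_def partition_on_def)
  then show "degree (Abs_ubp f) = n" by (simp add: degree_def *)
qed

lemma ubp_empty_rep: "graph ubp_empty = {}" "degree ubp_empty = 0"
  unfolding ubp_empty_def by (rule graph_Abs_ubp[OF is_ubp_empty])+

lemma is_ubp_converse: "is_ubp n f \<Longrightarrow> is_ubp n (f\<inverse>)"
  by (auto simp: is_ubp_def)

lemma ubp_inverse_rep: "graph (ubp_inverse f) = (graph f)\<inverse>" "degree (ubp_inverse f) = degree f"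
  unfolding ubp_inverse_def by (rule graph_Abs_ubp[OF is_ubp_converse[OF is_ubp_degree]])+

lemma is_ubp_perm:
  assumes "\<sigma> permutes {1..n}" shows "is_ubp n ((\<lambda>i. ({i}, {\<sigma> i})) ` {1..n})"
proof -
  have D: "Domain ((\<lambda>i. ({i}, {\<sigma> i})) ` {1..n}) = (\<lambda>i. {i}) ` {1..n}"
    by (auto simp: Domain_fst image_image)
  have R: "Range ((\<lambda>i. ({i}, {\<sigma> i})) ` {1..n}) = (\<lambda>i. {i}) ` {1..n}"
  proof -
    have "Range ((\<lambda>i. ({i}, {\<sigma> i})) ` {1..n}) = (\<lambda>i. {i}) ` (\<sigma> ` {1..n})"
      by (auto simp: Range_def image_def)
    then show ?thesis by (simp only: permutes_image[OF assms])
  qed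
  show ?thesis
    unfolding is_ubp_def D R
    using partition_on_singletons[of "{1..n}"] permutes_inj[OF assms]
    by (auto simp: single_valued_def dest: injD)
qed

lemma ubp_of_perm_rep:
  assumes "\<sigma> permutes {1..n}"
  shows "graph (ubp_of_perm n \<sigma>) = (\<lambda>i. ({i}, {\<sigma> i})) ` {1..n}" "degree (ubp_of_perm n \<sigma>) = n"
  unfolding ubp_of_perm_def by (rule graph_Abs_ubp[OF is_ubp_perm[OF assms]])+

lemma partition_on_shift:
  fixes n m :: nat
  assumes "partition_on {1..n} P" "partition_on {1..m} Q"
  shows "partition_on {1..n + m} (P \<union> (`) (\<lambda>a. a + n) ` Q)"
proof -
  have im: "(\<lambda>a. a + n) ` {1..m} = {n + 1..n + m}"
    using image_add_atLeastAtMost'[of n 1 m] by (simp add: add.commute)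
  have "partition_on ((\<lambda>a. a + n) ` {1..m}) ((`) (\<lambda>a. a + n) ` Q - {{}})"
    using assms(2) by (rule partition_on_inj_image) auto
  moreover have "{} \<notin> (`) (\<lambda>a. a + n) ` Q"
    using assms(2) by (auto simp: partition_on_def)
  ultimately have Q: "partition_on {n + 1..n + m} ((`) (\<lambda>a. a + n) ` Q)"
    by (simp add: im add.commute)
  have un: "{1..n + m} = {1..n} \<union> {n + 1..n + m}" by auto
  show ?thesis
  proof (rule partition_onI)
    show "\<Union> (P \<union> (`) (\<lambda>a. a + n) ` Q) = {1..n + m}"
      using partition_onD1[OF assms(1)] partition_onD1[OF Q] un by auto
    show "{} \<notin> P \<union> (`) (\<lambda>a. a + n) ` Q"
      using partition_onD3[OF assms(1)] partition_onD3[OF Q] by auto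
  next
    fix p q
    assume pq: "p \<in> P \<union> (`) (\<lambda>a. a + n) ` Q" "q \<in> P \<union> (`) (\<lambda>a. a + n) ` Q" "p \<noteq> q"
    have P1: "\<And>p. p \<in> P \<Longrightarrow> p \<subseteq> {1..n}" using partition_onD1[OF assms(1)] by auto
    have Q1: "\<And>p. p \<in> (`) (\<lambda>a. a + n) ` Q \<Longrightarrow> p \<subseteq> {n + 1..n + m}"
      using partition_onD1[OF Q] by auto
    have d: "disjnt {1..n} {n + 1..n + m}" by (auto simp: disjnt_def)
    show "disjnt p q"
      using pq(1)
    proof
      assume p: "p \<in> P"
      show ?thesis using pq(2)
      proof
        assume "q \<in> P" with p pq(3) partition_onD2[OF assms(1)] show ?thesis
          by (auto simp: pairwise_def)
      next
        assume "q \<in> (`) (\<lambda>a. a + n) ` Q"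
        with P1[OF p] Q1[OF this] d show ?thesis by (meson disjnt_subset1 disjnt_subset2)
      qed
    next
      assume p: "p \<in> (`) (\<lambda>a. a + n) ` Q"
      show ?thesis using pq(2)
      proof
        assume "q \<in> P"
        with P1[OF this] Q1[OF p] d show ?thesis
          by (meson disjnt_subset1 disjnt_subset2 disjnt_sym)
      next
        assume "q \<in> (`) (\<lambda>a. a + n) ` Q"
        with p pq(3) partition_onD2[OF Q] show ?thesis by (meson pairwiseD)
      qed
    qed
  qed
qed

lemma is_ubp_concat:
  assumes f: "is_ubp n f" and g: "is_ubp m g"
  shows "is_ubp (n + m) (concat_graph n f g)"
proof -
  define s where "s = (\<lambda>a. a + n) "
  define t where "t = (\<lambda>(A, B). (s ` A, s ` B))"
  have inj: "inj s" by (auto simp: s_def)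
  have D: "Domain (f \<union> t ` g) = Domain f \<union> (`) s ` Domain g"
    by (simp add: t_def Domain_fst image_Un image_image case_prod_unfold)
  have R: "Range (f \<union> t ` g) = Range f \<union> (`) s ` Range g"
    by (simp add: t_def Range_snd image_Un image_image case_prod_unfold)
  have blocks: "A \<noteq> {} \<and> B \<noteq> {} \<and> A \<subseteq> {1..k} \<and> B \<subseteq> {1..k}" if "is_ubp k h" "(A, B) \<in> h" for k h A B
  proof -
    have "A \<in> Domain h" "B \<in> Range h" using that(2) by auto
    moreover have "partition_on {1..k} (Domain h)" "partition_on {1..k} (Range h)"
      using that(1) by (auto simp: is_ubp_def)
    ultimately show ?thesis by (metis Union_upper partition_onD1 partition_onD3)
  qed
  have sne: "A \<noteq> s ` A'" if "A \<noteq> {}" "A \<subseteq> {1..n}" "A' \<subseteq> {1..m}" for A A'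
  proof
    assume eq: "A = s ` A'"
    obtain a where a: "a \<in> A" using \<open>A \<noteq> {}\<close> by blast
    then obtain a' where "a' \<in> A'" "a = a' + n" using eq by (auto simp: s_def)
    moreover have "a \<le> n" "a' \<ge> 1" using a \<open>a' \<in> A'\<close> that by auto
    ultimately show False by simp
  qed
  have ne1: False if "(s ` A', B) \<in> f" "(A', B') \<in> g" for A' B B'
    using blocks[OF f that(1)] blocks[OF g that(2)] sne[of "s ` A'" A'] by simp
  have ne2: False if "(A, s ` B') \<in> f" "(A', B') \<in> g" for A A' B'
    using blocks[OF f that(1)] blocks[OF g that(2)] sne[of "s ` B'" B'] by simp
  have "single_valued (f \<union> t ` g)"
  proof (rule single_valuedI)
    fix x y z assume "(x, y) \<in> f \<union> t ` g" "(x, z) \<in> f \<union> t ` g"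
    then consider "(x, y) \<in> f" "(x, z) \<in> f"
      | A B C D where "(A, B) \<in> g" "(C, D) \<in> g" "x = s ` A" "x = s ` C" "y = s ` B" "z = s ` D"
      by (auto simp: t_def dest: ne1 ne2)
    then show "y = z"
    proof cases
      case 1
      then show ?thesis using f by (auto simp: is_ubp_def single_valued_def)
    next
      case 2
      then have "A = C" by (simp add: inj_image_eq_iff[OF inj])
      with 2 g have "B = D" by (auto simp: is_ubp_def single_valued_def)
      with 2 show ?thesis by simp
    qed
  qed
  moreover have "single_valued ((f \<union> t ` g)\<inverse>)"
  proof (rule single_valuedI)
    fix x y z assume "(x, y) \<in> (f \<union> t ` g)\<inverse>" "(x, z) \<in> (f \<union> t ` g)\<inverse>"
    then consider "(y, x) \<in> f" "(z, x) \<in> f"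
      | A B C D where "(A, B) \<in> g" "(C, D) \<in> g" "y = s ` A" "z = s ` C" "x = s ` B" "x = s ` D"
      by (auto simp: t_def dest: ne1 ne2)
    then show "y = z"
    proof cases
      case 1
      then show ?thesis using f by (auto simp: is_ubp_def single_valued_def)
    next
      case 2
      then have "B = D" by (simp add: inj_image_eq_iff[OF inj])
      with 2 g have "A = C" by (auto simp: is_ubp_def single_valued_def)
      with 2 show ?thesis by simp
    qed
  qed
  moreover have "\<forall>(A, B)\<in>f \<union> t ` g. card A = card B"
  proof -
    have "card (s ` A) = card A" for A using inj by (auto intro: card_image inj_on_subset)
    then show ?thesis using f g by (auto simp: is_ubp_def t_def)
  qed
  moreover have "partition_on {1..n + m} (Domain (f \<union> t ` g))" "partition_on {1..n + m} (Range (f \<union> t ` g))"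
    unfolding D R s_def using f g unfolding is_ubp_def by (intro partition_on_shift; blast)+
  moreover have "f \<union> t ` g = concat_graph n f g" by (simp add: concat_graph_def t_def s_def)
  ultimately show ?thesis by (simp only: is_ubp_def)
qed

lemma ubp_concat_rep:
  "graph (ubp_concat f g) = concat_graph (degree f) (graph f) (graph g)"
  "degree (ubp_concat f g) = degree f + degree g"
  unfolding ubp_concat_def
  by (rule graph_Abs_ubp[OF is_ubp_concat[OF is_ubp_degree is_ubp_degree]])+

lemma finest_join:
  assumes B: "partition_on S \<B>" and C: "partition_on S \<C>"
  shows "refines S \<B> (finest_join S \<B> \<C>)" "refines S \<C> (finest_join S \<B> \<C>)"
    "\<And>\<E>'. refines S \<B> \<E>' \<Longrightarrow> refines S \<C> \<E>' \<Longrightarrow> refines S (finest_join S \<B> \<C>) \<E>'"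
proof -
  define rel where "rel P = {(x, y). \<exists>p\<in>P. x \<in> p \<and> y \<in> p}" for P :: "'a set set"
  have rel: "equiv S (rel P)" "S // rel P = P" if "partition_on S P" for P
    using equiv_partition_on[OF that] partition_on_eq_quotient[OF that] by (auto simp: rel_def)
  have refI: "refines S P Q" if P: "partition_on S P" and Q: "partition_on S Q" and PQ: "rel P \<subseteq> rel Q" for P Q
    unfolding refines_def
  proof (intro conjI ballI P Q)
    fix X assume X: "X \<in> P"
    have "X \<noteq> {}" using P X unfolding partition_on_def by metis
    then obtain x where x: "x \<in> X" by blast
    have "x \<in> S" using X x partition_onD1[OF P] by auto
    then obtain Y where Y: "Y \<in> Q" "x \<in> Y" using partition_onD1[OF Q] by auto
    have "X \<subseteq> Y"
    proof
      fix z assume "z \<in> X"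
      then have "(x, z) \<in> rel Q" using X x PQ by (auto simp: rel_def)
      then obtain q where q: "q \<in> Q" "x \<in> q" "z \<in> q" by (auto simp: rel_def)
      then have "q = Y" using Y partition_onD2[OF Q] by (auto simp: disjoint_def)
      then show "z \<in> Y" using q by simp
    qed
    with Y show "\<exists>Y\<in>Q. X \<subseteq> Y" by auto
  qed
  have refD: "rel P \<subseteq> rel Q" if "refines S P Q" for P Q
    using that unfolding refines_def rel_def by blast
  define J where "J = {r. equiv S r \<and> rel \<B> \<subseteq> r \<and> rel \<C> \<subseteq> r}"
  have univ: "S \<times> S \<in> J"
    using rel(1)[OF B] rel(1)[OF C] unfolding J_def
    by (auto simp: equiv_def refl_on_def sym_def trans_def)
  have eqJ: "equiv S (\<Inter>J)"
  proof (rule equivI)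
    show "\<Inter>J \<subseteq> S \<times> S" using univ by blast
    show "refl_on S (\<Inter>J)" by (auto simp: refl_on_def J_def equiv_def)
    show "sym (\<Inter>J)" by (rule symI) (auto simp: J_def equiv_def dest: symD)
    show "trans (\<Inter>J)" by (rule transI) (auto simp: J_def equiv_def intro: transD)
  qed
  define E where "E = S // \<Inter>J"
  have E: "partition_on S E" unfolding E_def using eqJ by (rule partition_on_quotient)
  have relE: "rel E = \<Inter>J"
  proof -
    have "(x, y) \<in> rel E \<longleftrightarrow> (x, y) \<in> \<Inter>J" for x y
    proof
      assume "(x, y) \<in> rel E"
      then obtain p where "p \<in> S // \<Inter>J" "x \<in> p" "y \<in> p" by (auto simp: rel_def E_def)
      then show "(x, y) \<in> \<Inter>J" using quotient_eq_iff[OF eqJ] by blast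
    next
      assume xy: "(x, y) \<in> \<Inter>J"
      then have "x \<in> S" using eqJ by (meson equiv_class_eq_iff)
      have "\<Inter>J `` {x} \<in> E" unfolding E_def using \<open>x \<in> S\<close> by (rule quotientI)
      moreover have "x \<in> \<Inter>J `` {x}" using eqJ \<open>x \<in> S\<close> by (rule equiv_class_self)
      moreover have "y \<in> \<Inter>J `` {x}" using xy by blast
      ultimately show "(x, y) \<in> rel E" unfolding rel_def by blast
    qed
    then show ?thesis by auto
  qed
  have props: "refines S \<B> E" "refines S \<C> E"
    by (rule refI[OF B E] refI[OF C E], unfold relE J_def, blast)+
  have least: "refines S E E'" if "refines S \<B> E'" "refines S \<C> E'" for E'
  proof (rule refI[OF E])
    show E': "partition_on S E'" using that by (auto simp: refines_def)
    have "rel E' \<in> J" unfolding J_def using rel(1)[OF E'] refD that by blast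
    then show "rel E \<subseteq> rel E'" unfolding relE by blast
  qed
  have "finest_join S \<B> \<C> = E"
    unfolding finest_join_def
  proof (rule the_equality)
    show "refines S \<B> E \<and> refines S \<C> E \<and>
      (\<forall>\<E>'. refines S \<B> \<E>' \<and> refines S \<C> \<E>' \<longrightarrow> refines S E \<E>')"
      using props least by blast
  next
    fix F assume F: "refines S \<B> F \<and> refines S \<C> F \<and>
      (\<forall>\<E>'. refines S \<B> \<E>' \<and> refines S \<C> \<E>' \<longrightarrow> refines S F \<E>')"
    show "F = E"
    proof (rule refines_asym)
      show "refines S F E" using F props by blast
      show "refines S E F" using F by (intro least) simp_all
    qed
  qed
  then show "refines S \<B> (finest_join S \<B> \<C>)" "refines S \<C> (finest_join S \<B> \<C>)"
    "\<And>\<E>'. refines S \<B> \<E>' \<Longrightarrow> refines S \<C> \<E>' \<Longrightarrow> refines S (finest_join S \<B> \<C>) \<E>'"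
    using props least by auto
qed

lemma ubp_coarsen:
  assumes f: "is_ubp n f" and E: "refines {1..n} (Range f) \<E>"
  defines "X \<equiv> \<lambda>E. \<Union>{A. \<exists>B. (A, B) \<in> f \<and> B \<subseteq> E}"
  shows "partition_on {1..n} (X ` \<E>)" "inj_on X \<E>" "\<And>E. E \<in> \<E> \<Longrightarrow> card (X E) = card E"
proof -
  have pE: "partition_on {1..n} \<E>" using E by (auto simp: refines_def)
  have pD: "partition_on {1..n} (Domain f)" and pR: "partition_on {1..n} (Range f)"
    and sv: "single_valued f" and sv': "single_valued (f\<inverse>)"
    and crd: "\<And>A B. (A, B) \<in> f \<Longrightarrow> card A = card B"
    using f by (auto simp: is_ubp_def)
  have fin: "finite A" if "A \<in> Domain f" for A
    using partition_onD1[OF pD] that by (metis Union_upper finite_atLeastAtMost finite_subset)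
  have finR: "finite A" if "A \<in> Range f" for A
    using partition_onD1[OF pR] that by (metis Union_upper finite_atLeastAtMost finite_subset)
  have same: "E = E'" if "E \<in> \<E>" "E' \<in> \<E>" "x \<in> E" "x \<in> E'" for E E' x
    using that partition_onD2[OF pE] by (auto simp: disjoint_def)
  have neB: "B \<noteq> {}" if "(A, B) \<in> f" for A B
    using that partition_onD3[OF pR] by auto
  show cardX: "card (X E) = card E" if "E \<in> \<E>" for E
  proof -
    define F where "F = {p \<in> f. snd p \<subseteq> E}"
    have pt: "partition_on E {p \<in> Range f. p \<subseteq> E}"
      using refines_obtains_subset[OF E that] .
    have "snd ` F = {p \<in> Range f. p \<subseteq> E}" by (force simp: F_def)
    then have EU: "E = \<Union>(snd ` F)" using partition_onD1[OF pt] by simp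
    have XU: "X E = \<Union>(fst ` F)" by (force simp: X_def F_def)
    have inj1: "inj_on fst F" using sv by (force simp: inj_on_def F_def single_valued_def)
    have inj2: "inj_on snd F" using sv' by (force simp: inj_on_def F_def single_valued_def)
    have "fst ` F \<subseteq> Domain f" "snd ` F \<subseteq> Range f" by (force simp: F_def)+
    then have d: "disjoint (fst ` F)" "disjoint (snd ` F)"
      and ff: "\<And>A. A \<in> fst ` F \<Longrightarrow> finite A" "\<And>A. A \<in> snd ` F \<Longrightarrow> finite A"
      using partition_onD2[OF pD] partition_onD2[OF pR] fin finR
      by (blast intro: pairwise_subset)+
    have "card (X E) = sum card (fst ` F)"
      unfolding XU by (rule card_Union_disjoint) (use d ff in auto)
    also have "\<dots> = (\<Sum>p\<in>F. card (fst p))" using inj1 by (simp add: sum.reindex)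
    also have "\<dots> = (\<Sum>p\<in>F. card (snd p))"
      by (rule sum.cong) (use crd in \<open>auto simp: F_def\<close>)
    also have "\<dots> = sum card (snd ` F)" using inj2 by (simp add: sum.reindex)
    also have "\<dots> = card (\<Union>(snd ` F))"
      by (rule card_Union_disjoint[symmetric]) (use d ff in auto)
    also have "\<dots> = card E" using arg_cong[OF EU, of card] by (rule sym)
    finally show ?thesis .
  qed
  have neX: "X E \<noteq> {}" if "E \<in> \<E>" for E
  proof -
    have "E \<noteq> {}" "finite E"
      using that partition_onD3[OF pE] partition_onD1[OF pE]
      by (auto, metis Union_upper finite_atLeastAtMost finite_subset)
    then show ?thesis using cardX[OF that] by auto
  qed
  have disj: "E = E'" if "E \<in> \<E>" "E' \<in> \<E>" "x \<in> X E" "x \<in> X E'" for E E' x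
  proof -
    obtain A B A' B' where 1: "(A, B) \<in> f" "B \<subseteq> E" "x \<in> A" "(A', B') \<in> f" "B' \<subseteq> E'" "x \<in> A'"
      using \<open>x \<in> X E\<close> \<open>x \<in> X E'\<close> by (auto simp: X_def)
    then have "A \<in> Domain f" "A' \<in> Domain f" "A \<inter> A' \<noteq> {}" by auto
    then have "A = A'" using partition_onD2[OF pD] unfolding disjoint_def by blast
    then have "B = B'" using 1 sv by (auto dest: single_valuedD)
    then show ?thesis using 1 neB[OF 1(1)] same[OF \<open>E \<in> \<E>\<close> \<open>E' \<in> \<E>\<close>] by blast
  qed
  show "inj_on X \<E>"
  proof (rule inj_onI)
    fix E E' assume "E \<in> \<E>" "E' \<in> \<E>" "X E = X E'"
    moreover obtain x where "x \<in> X E" using neX[OF \<open>E \<in> \<E>\<close>] by blast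
    ultimately show "E = E'" using disj by simp
  qed
  show "partition_on {1..n} (X ` \<E>)"
  proof (rule partition_onI)
    show "\<Union> (X ` \<E>) = {1..n}"
    proof
      show "\<Union> (X ` \<E>) \<subseteq> {1..n}" using partition_onD1[OF pD] by (auto simp: X_def)
      show "{1..n} \<subseteq> \<Union> (X ` \<E>)"
      proof
        fix x assume "x \<in> {1..n}"
        then have "x \<in> \<Union>(Domain f)" using partition_onD1[OF pD] by blast
        then obtain A B where "(A, B) \<in> f" "x \<in> A" by blast
        moreover then obtain E where "E \<in> \<E>" "B \<subseteq> E"
          using E by (auto simp: refines_def)
        ultimately show "x \<in> \<Union> (X ` \<E>)" unfolding X_def by blast
      qed
    qed
    show "{} \<notin> X ` \<E>" using neX by auto
    show "disjnt p q" if "p \<in> X ` \<E>" "q \<in> X ` \<E>" "p \<noteq> q" for p q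
      using that disj unfolding disjnt_def by blast
  qed
qed

lemma is_ubp_mult:
  assumes f: "is_ubp n f" and g: "is_ubp n g"
  shows "is_ubp n (mult_graph n g f)"
proof -
  define \<E> where "\<E> = finest_join {1..n} (Range f) (Domain g)"
  define X where "X = (\<lambda>E. \<Union>{A. \<exists>B. (A, B) \<in> f \<and> B \<subseteq> E})"
  define Y where "Y = (\<lambda>E. \<Union>{D. \<exists>C. (C, D) \<in> g \<and> C \<subseteq> E})"
  have E: "refines {1..n} (Range f) \<E>" "refines {1..n} (Range (g\<inverse>)) \<E>"
    using finest_join[of "{1..n}" "Range f" "Domain g"] f g
    by (simp_all add: is_ubp_def \<E>_def)
  have Xp: "partition_on {1..n} (X ` \<E>)" "inj_on X \<E>" "\<And>E. E \<in> \<E> \<Longrightarrow> card (X E) = card E"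
    using ubp_coarsen[OF f E(1)] by (simp_all add: X_def)
  have Yp: "partition_on {1..n} (Y ` \<E>)" "inj_on Y \<E>" "\<And>E. E \<in> \<E> \<Longrightarrow> card (Y E) = card E"
    using ubp_coarsen[OF is_ubp_converse[OF g] E(2)] by (simp_all add: Y_def)
  have eq: "mult_graph n g f = (\<lambda>E. (X E, Y E)) ` \<E>"
    by (simp add: mult_graph_def \<E>_def X_def Y_def)
  have "Domain (mult_graph n g f) = X ` \<E>" "Range (mult_graph n g f) = Y ` \<E>"
    unfolding eq by force+
  with Xp Yp show ?thesis
    unfolding is_ubp_def by (auto simp: eq single_valued_def inj_on_def)
qed

lemma ubp_mult_rep:
  assumes "degree g = degree f"
  shows "graph (ubp_mult g f) = mult_graph (degree f) (graph g) (graph f)"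
    "degree (ubp_mult g f) = degree f"
  unfolding ubp_mult_def
  by (rule graph_Abs_ubp[OF is_ubp_mult[OF is_ubp_degree is_ubp_degree[of g, unfolded assms]]])+

section \<open>Graded Hopf algebras\<close>

text \<open>
  The data of a graded Hopf algebra \<open>H = \<Oplus>\<^sub>n H\<^sub>n\<close> over \<open>'k\<close>, without the axioms. The additive structure is that of the
  type \<open>'a\<close>. As the library has no tensor products over a ring, the data include a model of \<open>H \<otimes> H\<close>
  inside \<open>'t\<close>, given by the bilinear map \<open>(x, y) \<mapsto> x \<otimes> y\<close>.
\<close>

record ('k, 'a, 't) graded_hopf =
  component :: "nat \<Rightarrow> 'a set"
  scale :: "'k \<Rightarrow> 'a \<Rightarrow> 'a"
  mult :: "'a \<Rightarrow> 'a \<Rightarrow> 'a"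
  unit :: 'a
  tensor :: "'a \<Rightarrow> 'a \<Rightarrow> 't"
  comult :: "'a \<Rightarrow> 't"
  counit :: "'a \<Rightarrow> 'k"

definition space_of :: "('k, 'a::comm_monoid_add, 't) graded_hopf \<Rightarrow> 'a set" where
  "space_of H = {\<Sum>n<N. x n | x N. \<forall>n. x n \<in> component H n}"

definition linear_between ::
  "('k, 'a::comm_monoid_add, 't) graded_hopf \<Rightarrow> ('k, 'b::comm_monoid_add, 'u) graded_hopf
    \<Rightarrow> ('a \<Rightarrow> 'b) \<Rightarrow> bool" where
  "linear_between A B \<phi> \<longleftrightarrow>
     (\<forall>x\<in>space_of A. \<phi> x \<in> space_of B) \<and>
     (\<forall>x\<in>space_of A. \<forall>y\<in>space_of A. \<phi> (x + y) = \<phi> x + \<phi> y) \<and>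
     (\<forall>c. \<forall>x\<in>space_of A. \<phi> (scale A c x) = scale B c (\<phi> x))"

text \<open>
  \<open>tensor_lift H \<beta>\<close> is the linear map on \<open>H \<otimes> H\<close> induced by the bilinear map \<open>\<beta>\<close>:
  it sends \<open>\<Sum>\<^sub>i a\<^sub>i \<otimes> b\<^sub>i\<close> to \<open>\<Sum>\<^sub>i \<beta> a\<^sub>i b\<^sub>i\<close>.
\<close>

definition tensor_lift ::
  "('k, 'a::comm_monoid_add, 't::comm_monoid_add) graded_hopf
    \<Rightarrow> ('a \<Rightarrow> 'a \<Rightarrow> 'v::comm_monoid_add) \<Rightarrow> 't \<Rightarrow> 'v" where
  "tensor_lift H \<beta> t = (THE v. \<exists>ps. set ps \<subseteq> space_of H \<times> space_of H \<and>
     t = (\<Sum>(a, b)\<leftarrow>ps. tensor H a b) \<and> v = (\<Sum>(a, b)\<leftarrow>ps. \<beta> a b))"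

definition antipode ::
  "('k, 'a::comm_monoid_add, 't::comm_monoid_add) graded_hopf \<Rightarrow> ('a \<Rightarrow> 'a) \<Rightarrow> bool" where
  "antipode H S \<longleftrightarrow> linear_between H H S \<and>
     (\<forall>x\<in>space_of H.
        tensor_lift H (\<lambda>a b. mult H (S a) b) (comult H x) = scale H (counit H x) (unit H) \<and>
        tensor_lift H (\<lambda>a b. mult H a (S b)) (comult H x) = scale H (counit H x) (unit H))"

text \<open>
  \<open>graded_hopf_hom\<close> and \<open>graded_hopf_iso\<close> concern the structure maps of \<open>A\<close> and \<open>B\<close> only, and are
  meant for graded Hopf algebras. The antipodes \<open>S\<close> and \<open>T\<close> in the last clause are then unique.
\<close>

definition graded_hopf_hom ::
  "('k, 'a::comm_monoid_add, 't::comm_monoid_add) graded_hopf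
    \<Rightarrow> ('k, 'b::comm_monoid_add, 'u::comm_monoid_add) graded_hopf \<Rightarrow> ('a \<Rightarrow> 'b) \<Rightarrow> bool" where
  "graded_hopf_hom A B \<phi> \<longleftrightarrow>
     linear_between A B \<phi> \<and>
     (\<forall>n. \<forall>x\<in>component A n. \<phi> x \<in> component B n) \<and>
     (\<forall>x\<in>space_of A. \<forall>y\<in>space_of A. \<phi> (mult A x y) = mult B (\<phi> x) (\<phi> y)) \<and>
     \<phi> (unit A) = unit B \<and>
     (\<forall>x\<in>space_of A.
        comult B (\<phi> x) = tensor_lift A (\<lambda>a b. tensor B (\<phi> a) (\<phi> b)) (comult A x)) \<and>
     (\<forall>x\<in>space_of A. counit B (\<phi> x) = counit A x) \<and>
     (\<forall>S T. antipode A S \<and> antipode B T \<longrightarrow> (\<forall>x\<in>space_of A. \<phi> (S x) = T (\<phi> x)))"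

definition graded_hopf_iso ::
  "('k, 'a::comm_monoid_add, 't::comm_monoid_add) graded_hopf
    \<Rightarrow> ('k, 'b::comm_monoid_add, 'u::comm_monoid_add) graded_hopf \<Rightarrow> ('a \<Rightarrow> 'b) \<Rightarrow> bool" where
  "graded_hopf_iso A B \<phi> \<longleftrightarrow> graded_hopf_hom A B \<phi> \<and> bij_betw \<phi> (space_of A) (space_of B)"

text \<open>
  The graded dual \<open>\<Oplus>\<^sub>n H\<^sub>n\<^sup>*\<close> of a graded Hopf algebra whose underlying space is all of \<open>'a\<close> and whose
  components are free of finite rank. An element of \<open>H\<^sub>n\<^sup>*\<close> is a linear functional on \<open>H\<close> that
  vanishes on the other components; \<open>H\<^sup>* \<otimes> H\<^sup>*\<close> is realised inside the functionals on \<open>H \<otimes> H\<close> by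
  \<open>(\<alpha> \<otimes> \<beta>)(x \<otimes> y) = \<alpha> x * \<beta> y\<close>. The product and the coproduct are the transposes
  of the coproduct and the product of \<open>H\<close>.
\<close>

definition graded_dual ::
  "('k::{comm_ring, comm_monoid_mult}, 'a::comm_monoid_add, 't::comm_monoid_add) graded_hopf
    \<Rightarrow> ('k, 'a \<Rightarrow> 'k, 't \<Rightarrow> 'k) graded_hopf" where
  "graded_dual H = \<lparr>
     component = (\<lambda>n. {\<alpha>. (\<forall>x y. \<alpha> (x + y) = \<alpha> x + \<alpha> y) \<and> (\<forall>c x. \<alpha> (scale H c x) = c * \<alpha> x) \<and>
                          (\<forall>m. m \<noteq> n \<longrightarrow> (\<forall>x\<in>component H m. \<alpha> x = 0))}),
     scale = (\<lambda>c \<alpha> x. c * \<alpha> x),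
     mult = (\<lambda>\<alpha> \<beta> x. tensor_lift H (\<lambda>a b. \<alpha> a * \<beta> b) (comult H x)),
     unit = counit H,
     tensor = (\<lambda>\<alpha> \<beta>. tensor_lift H (\<lambda>a b. \<alpha> a * \<beta> b)),
     comult = (\<lambda>\<alpha> t. \<alpha> (tensor_lift H (mult H) t)),
     counit = (\<lambda>\<alpha>. \<alpha> (unit H))\<rparr>"

section \<open>The Hopf algebra of uniform block permutations\<close>

text \<open>
  The free module on \<open>'b\<close> is \<open>'b \<Rightarrow>\<^sub>0 'k\<close>. The sort \<open>{comm_ring, comm_monoid_mult}\<close> is used for
  the ground ring because \<open>comm_ring_1\<close> excludes the zero ring.
\<close>

definition basis :: "'b \<Rightarrow> ('b \<Rightarrow>\<^sub>0 'k::{comm_ring, comm_monoid_mult})" where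
  "basis b = Poly_Mapping.single b 1"

definition free_scale ::
  "'k::{comm_ring, comm_monoid_mult} \<Rightarrow> ('b \<Rightarrow>\<^sub>0 'k) \<Rightarrow> ('b \<Rightarrow>\<^sub>0 'k)" where
  "free_scale c x = Poly_Mapping.map (\<lambda>a. c * a) x"

definition linear_extension ::
  "('b \<Rightarrow> ('d \<Rightarrow>\<^sub>0 'k::{comm_ring, comm_monoid_mult})) \<Rightarrow> ('b \<Rightarrow>\<^sub>0 'k) \<Rightarrow> ('d \<Rightarrow>\<^sub>0 'k)" where
  "linear_extension F x =
     (\<Sum>b\<in>Poly_Mapping.keys x. free_scale (Poly_Mapping.lookup x b) (F b))"

definition bilinear_extension ::
  "('b \<Rightarrow> 'c \<Rightarrow> ('d \<Rightarrow>\<^sub>0 'k::{comm_ring, comm_monoid_mult}))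
    \<Rightarrow> ('b \<Rightarrow>\<^sub>0 'k) \<Rightarrow> ('c \<Rightarrow>\<^sub>0 'k) \<Rightarrow> ('d \<Rightarrow>\<^sub>0 'k)" where
  "bilinear_extension F x y = linear_extension (\<lambda>b. linear_extension (F b) y) x"

definition shuffles_perm :: "nat \<Rightarrow> nat \<Rightarrow> (nat \<Rightarrow> nat) set" where
  "shuffles_perm n m =
     {\<xi>. \<xi> permutes {1..n + m} \<and> strict_mono_on {1..n} \<xi> \<and> strict_mono_on {n + 1..n + m} \<xi>}"

definition sh :: "nat \<Rightarrow> nat \<Rightarrow> (ubp \<Rightarrow>\<^sub>0 'k::{comm_ring, comm_monoid_mult})" where
  "sh n m = (\<Sum>\<xi>\<in>shuffles_perm n m. basis (ubp_of_perm (n + m) \<xi>))"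

text \<open>
  This is the product of the monoid algebra of \<open>P\<^sub>n\<close> when both arguments are supported in degree \<open>n\<close>.
\<close>

definition monoid_algebra_mult ::
  "(ubp \<Rightarrow>\<^sub>0 'k::{comm_ring, comm_monoid_mult}) \<Rightarrow> (ubp \<Rightarrow>\<^sub>0 'k) \<Rightarrow> (ubp \<Rightarrow>\<^sub>0 'k)" where
  "monoid_algebra_mult = bilinear_extension (\<lambda>g f. basis (ubp_mult g f))"

definition shuffle_mult ::
  "ubp \<Rightarrow> ubp \<Rightarrow> (ubp \<Rightarrow>\<^sub>0 'k::{comm_ring, comm_monoid_mult})" where
  "shuffle_mult f g = monoid_algebra_mult (sh (degree f) (degree g)) (basis (ubp_concat f g))"

definition breaking_points :: "ubp \<Rightarrow> nat set" where
  "breaking_points f = {i. i \<le> degree f \<and> (\<exists>\<C>. \<C> \<subseteq> Range (graph f) \<and> {1..i} = \<Union>\<C>)}"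

text \<open>
  For a breaking point \<open>i\<close> of \<open>f\<close>, the unique triple \<open>(\<xi>, f\<^sub>(\<^sub>i\<^sub>), f'\<^sub>(\<^sub>n\<^sub>-\<^sub>i\<^sub>))\<close> with
  \<open>f = (f\<^sub>(\<^sub>i\<^sub>) \<times> f'\<^sub>(\<^sub>n\<^sub>-\<^sub>i\<^sub>)) \<cdot> \<xi>\<^sup>-\<^sup>1\<close>.
\<close>

definition splitting :: "ubp \<Rightarrow> nat \<Rightarrow> (nat \<Rightarrow> nat) \<times> ubp \<times> ubp" where
  "splitting f i = (THE (\<xi>, g, h). \<xi> \<in> shuffles_perm i (degree f - i) \<and>
     degree g = i \<and> degree h = degree f - i \<and>
     f = ubp_mult (ubp_concat g h) (ubp_of_perm (degree f) (inv \<xi>)))"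

definition break_comult ::
  "ubp \<Rightarrow> (ubp \<times> ubp \<Rightarrow>\<^sub>0 'k::{comm_ring, comm_monoid_mult})" where
  "break_comult f = (\<Sum>i\<in>breaking_points f. basis (snd (splitting f i)))"

text \<open>
  \<open>\<P> \<otimes> \<P>\<close> is the free module on pairs. The coefficient of \<open>\<emptyset>\<close> is the linear extension of
  \<open>\<epsilon>(\<emptyset>) = 1\<close> and \<open>\<epsilon>(f) = 0\<close> for \<open>f \<noteq> \<emptyset>\<close>.
\<close>

definition ubp_hopf ::
  "('k::{comm_ring, comm_monoid_mult}, ubp \<Rightarrow>\<^sub>0 'k, ubp \<times> ubp \<Rightarrow>\<^sub>0 'k) graded_hopf" where
  "ubp_hopf = \<lparr>
     component = (\<lambda>n. {x. \<forall>f\<in>Poly_Mapping.keys x. degree f = n}),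
     scale = free_scale,
     mult = bilinear_extension shuffle_mult,
     unit = basis ubp_empty,
     tensor = bilinear_extension (\<lambda>f g. basis (f, g)),
     comult = linear_extension break_comult,
     counit = (\<lambda>x. Poly_Mapping.lookup x ubp_empty)\<rparr>"

text \<open>The element \<open>f\<^sup>*\<close> of the dual basis.\<close>

definition dual_basis :: "ubp \<Rightarrow> ((ubp \<Rightarrow>\<^sub>0 'k::{comm_ring, comm_monoid_mult}) \<Rightarrow> 'k)" where
  "dual_basis f = (\<lambda>x. Poly_Mapping.lookup x f)"

end

(*
  Write ~f for the inverse of f. Identifying f* with ~f turns the assertion into
  one equality of structure constants: the coefficient of ~h in (~f) * (~g) equals the coefficient of
  f (x) g in the coproduct of h. The first counts the shuffles xi with ~h = xi . (~f x ~g), the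
  second the shuffles xi with h = (f x g) . xi^-1, and inversion exchanges the two conditions.
  The second number is at most 1: xi maps {1..i} onto the union of the domain blocks of
  h whose images lie in {1..i}, which determines xi and then f and g.

  The antipode of a connected bialgebra is determined by left convolution with the identity, by
  recursion on the degree; hence any two antipodes correspond under the isomorphism.
*)

theory Submission
  imports Defs "HOL-Library.Infinite_Set"
begin

section \<open>Relabelling blocks\<close>

text \<open>Inversion exchanges the two families of shuffles because it reverses products, commutes
  with concatenation and inverts permutations. As each count is at most 1, the structure constants
  are truth values, and their equality is an equivalence of two existence statements, valid over
  every ground ring, the zero ring included.

  The obstacle is the dual side. Its tensor square is only a part of the functionals on \<P>
  \<otimes> \<P>, and a lift there is a definite description over all representations as sums of
  pure tensors, so independence of the representation has to be proved. This is done by passing to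
  \<P> \<otimes> \<P>, where an element is determined by its coefficients at inverted basis pairs.
  The passage needs finite supports, which come from degree bounds and the finiteness of each
  degree.

  For the antipodes, the one on the dual is transported to \<P> and compared with the one given
  there through the convolution equation, not through formulas.\<close>

definition is_ubp_between :: "'a set \<Rightarrow> 'b set \<Rightarrow> ('a set \<times> 'b set) set \<Rightarrow> bool" where
  "is_ubp_between S T f \<longleftrightarrow>
     partition_on S (Domain f) \<and> partition_on T (Range f) \<and>
     single_valued f \<and> single_valued (f\<inverse>) \<and> (\<forall>(A, B)\<in>f. card A = card B)"

lemma is_ubp_iff_between: "is_ubp n f \<longleftrightarrow> is_ubp_between {1..n} {1..n} f"
  by (simp add: is_ubp_def is_ubp_between_def)

lemma is_ubp_between_blocks:
  assumes "is_ubp_between S T f" "(A, B) \<in> f"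
  shows "A \<subseteq> S" "B \<subseteq> T" "A \<noteq> {}" "B \<noteq> {}"
proof -
  have "A \<in> Domain f" "B \<in> Range f" using assms(2) by auto
  then show "A \<subseteq> S" "B \<subseteq> T" "A \<noteq> {}" "B \<noteq> {}"
    using assms(1) partition_onD1 partition_onD3 unfolding is_ubp_between_def
    by (metis Union_upper)+
qed

text \<open>The two sides are relabelled independently: a permutation factor on the right acts on
  the domain only, a concatenation shifts both. Domain and codomain have separate ground sets
  because half of a split block permutation lives on an arbitrary set of domain points but on an
  interval of codomain points.\<close>

definition map_blocks ::
  "('a \<Rightarrow> 'c) \<Rightarrow> ('b \<Rightarrow> 'd) \<Rightarrow> ('a set \<times> 'b set) set \<Rightarrow> ('c set \<times> 'd set) set" where
  "map_blocks s t f = (\<lambda>(A, B). (s ` A, t ` B)) ` f"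

lemma map_blocksI: "(A, B) \<in> f \<Longrightarrow> (s ` A, t ` B) \<in> map_blocks s t f"
  by (force simp: map_blocks_def)

lemma concat_graph_map_blocks:
  "concat_graph n f g = f \<union> map_blocks (\<lambda>a. a + n) (\<lambda>a. a + n) g"
  by (simp add: concat_graph_def map_blocks_def)

lemma map_blocks_map_blocks: "map_blocks s t (map_blocks s' t' f) = map_blocks (s \<circ> s') (t \<circ> t') f"
  by (auto simp: map_blocks_def image_image case_prod_unfold)

lemma map_blocks_Un: "map_blocks s t (f \<union> g) = map_blocks s t f \<union> map_blocks s t g"
  by (simp add: map_blocks_def image_Un)

lemma map_blocks_id [simp]: "map_blocks id id f = f"
  by (simp add: map_blocks_def)

lemma converse_map_blocks: "(map_blocks s t f)\<inverse> = map_blocks t s (f\<inverse>)"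
  by (force simp: map_blocks_def)

lemma Domain_map_blocks: "Domain (map_blocks s t f) = (`) s ` Domain f"
  and Range_map_blocks: "Range (map_blocks s t f) = (`) t ` Range f"
  by (simp_all add: map_blocks_def Domain_fst Range_snd image_image case_prod_unfold)

lemma map_blocks_cong:
  assumes "is_ubp_between S T f" "\<And>x. x \<in> S \<Longrightarrow> s x = s' x" "\<And>x. x \<in> T \<Longrightarrow> t x = t' x"
  shows "map_blocks s t f = map_blocks s' t' f"
proof -
  have "s ` A = s' ` A \<and> t ` B = t' ` B" if "(A, B) \<in> f" for A B
    using is_ubp_between_blocks[OF assms(1) that] assms(2,3) by (intro conjI image_cong) auto
  then show ?thesis unfolding map_blocks_def by (intro image_cong refl) (simp split: prod.split, metis)
qed

lemma is_ubp_between_map_blocks: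
  assumes f: "is_ubp_between S T f" and s: "inj_on s S" and t: "inj_on t T"
  shows "is_ubp_between (s ` S) (t ` T) (map_blocks s t f)"
proof -
  note D = Domain_map_blocks[of s t f] and R = Range_map_blocks[of s t f]
  have s_eq: "A = A'" if "(A, B) \<in> f" "(A', B') \<in> f" "s ` A = s ` A'" for A B A' B'
    using that is_ubp_between_blocks[OF f] inj_on_image_eq_iff[OF s] by metis
  have t_eq: "B = B'" if "(A, B) \<in> f" "(A', B') \<in> f" "t ` B = t ` B'" for A B A' B'
    using that is_ubp_between_blocks[OF f] inj_on_image_eq_iff[OF t] by metis
  have sv: "single_valued f" "single_valued (f\<inverse>)" and pt: "partition_on S (Domain f)" "partition_on T (Range f)"
    and crd: "\<And>A B. (A, B) \<in> f \<Longrightarrow> card A = card B"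
    using f by (auto simp: is_ubp_between_def)
  have "(`) s ` Domain f - {{}} = (`) s ` Domain f" "(`) t ` Range f - {{}} = (`) t ` Range f"
    using partition_onD3[OF pt(1)] partition_onD3[OF pt(2)] by auto
  then have "partition_on (s ` S) (Domain (map_blocks s t f))"
    "partition_on (t ` T) (Range (map_blocks s t f))"
    using partition_on_inj_image[OF pt(1) s] partition_on_inj_image[OF pt(2) t] by (simp_all add: D R)
  moreover have "single_valued (map_blocks s t f)"
  proof (rule single_valuedI)
    fix x y z assume "(x, y) \<in> map_blocks s t f" "(x, z) \<in> map_blocks s t f"
    then obtain A B A' B' where *: "(A, B) \<in> f" "(A', B') \<in> f" "x = s ` A" "x = s ` A'"
        "y = t ` B" "z = t ` B'"
      by (auto simp: map_blocks_def)
    then have "A = A'" using s_eq by metis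
    then show "y = z" using * sv(1) by (auto simp: single_valued_def)
  qed
  moreover have "single_valued ((map_blocks s t f)\<inverse>)"
  proof (rule single_valuedI)
    fix x y z assume "(x, y) \<in> (map_blocks s t f)\<inverse>" "(x, z) \<in> (map_blocks s t f)\<inverse>"
    then obtain A B A' B' where *: "(A, B) \<in> f" "(A', B') \<in> f" "x = t ` B" "x = t ` B'"
        "y = s ` A" "z = s ` A'"
      by (auto simp: map_blocks_def)
    then have "B = B'" using t_eq by metis
    then show "y = z" using * sv(2) by (auto simp: single_valued_def)
  qed
  moreover have "card (s ` A) = card (t ` B)" if "(A, B) \<in> f" for A B
    using crd[OF that] is_ubp_between_blocks[OF f that] s t
    by (simp add: card_image inj_on_subset)
  ultimately show ?thesis
    by (auto simp: is_ubp_between_def map_blocks_def)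
qed

text \<open>Blocks are subsets of the ground sets, on which the relabellings are injective. Shuffles
  and shifts can thus be cancelled.\<close>

lemma map_blocks_inject:
  assumes f: "is_ubp_between S T f" and g: "is_ubp_between S T g"
    and s: "inj_on s S" and t: "inj_on t T" and eq: "map_blocks s t f = map_blocks s t g"
  shows "f = g"
proof -
  have sub: "f \<subseteq> g" if f: "is_ubp_between S T f" and g: "is_ubp_between S T g"
    and eq: "map_blocks s t f = map_blocks s t g" for f g
  proof (rule subrelI)
    fix A B assume AB: "(A, B) \<in> f"
    then have "(s ` A, t ` B) \<in> map_blocks s t g" unfolding eq[symmetric] by (rule map_blocksI)
    then obtain A' B' where *: "(A', B') \<in> g" "s ` A = s ` A'" "t ` B = t ` B'"
      by (auto simp: map_blocks_def)
    then have "A = A'" "B = B'"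
      using is_ubp_between_blocks[OF f AB] is_ubp_between_blocks[OF g *(1)]
        inj_on_image_eq_iff[OF s] inj_on_image_eq_iff[OF t] by metis+
    then show "(A, B) \<in> g" using * by simp
  qed
  show ?thesis using sub[OF f g eq] sub[OF g f eq[symmetric]] by blast
qed

lemma partition_on_restrict:
  assumes "partition_on S P" "Q \<subseteq> P"
  shows "partition_on (\<Union>Q) Q"
  using assms unfolding partition_on_def by (auto intro: pairwise_subset)

lemma is_ubp_between_restrict:
  assumes "is_ubp_between S T f" "g \<subseteq> f"
  shows "is_ubp_between (\<Union>(Domain g)) (\<Union>(Range g)) g"
proof -
  have "Domain g \<subseteq> Domain f" "Range g \<subseteq> Range f" using assms(2) by auto
  then show ?thesis using assms unfolding is_ubp_between_def
    by (blast intro: partition_on_restrict single_valued_subset)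
qed

lemma ubp_eqI: "graph f = graph g \<Longrightarrow> f = g"
  by (simp add: graph_inject)

lemma graph_between: "is_ubp_between {1..degree f} {1..degree f} (graph f)"
  using is_ubp_degree is_ubp_iff_between by blast

section \<open>Multiplication by permutations\<close>

lemma refines_singletons:
  assumes "partition_on S P"
  shows "refines S ((\<lambda>i. {i}) ` S) P"
  using assms partition_on_singletons[of S] by (auto simp: refines_def partition_on_def)

text \<open>The partition into singletons is the bottom element of the refinement order, hence
  neutral for joins. This makes products with permutations computable.\<close>

lemma finest_join_singletons:
  assumes P: "partition_on S P"
  shows "finest_join S P ((\<lambda>i. {i}) ` S) = P" "finest_join S ((\<lambda>i. {i}) ` S) P = P"
proof -
  note sing = partition_on_singletons[of S]
  note r = refines_singletons[OF P] refines_refl[OF P]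
  show "finest_join S P ((\<lambda>i. {i}) ` S) = P"
    using finest_join[OF P sing] r by (intro refines_asym) auto
  show "finest_join S ((\<lambda>i. {i}) ` S) P = P"
    using finest_join[OF sing P] r by (intro refines_asym) auto
qed

text \<open>Nonempty disjoint blocks are contained in one another only if they are equal, so the
  union has the single member \<open>B\<close>.\<close>

lemma ubp_image_block:
  assumes f: "is_ubp_between S T f" and AB: "(A, B) \<in> f"
  shows "\<Union>{B'. \<exists>A'. (A', B') \<in> f \<and> A' \<subseteq> A} = B"
proof -
  have "A' = A" if "(A', B') \<in> f" "A' \<subseteq> A" for A' B'
  proof -
    have "A' \<in> Domain f" "A \<in> Domain f" using that AB by auto
    moreover have "A' \<inter> A \<noteq> {}" using that is_ubp_between_blocks[OF f that(1)] by blast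
    moreover have "disjoint (Domain f)" using f by (simp add: is_ubp_between_def partition_on_def)
    ultimately show ?thesis by (meson disjointD)
  qed
  moreover have "B' = B" if "(A, B') \<in> f" for B'
    using f that AB by (auto simp: is_ubp_between_def single_valued_def)
  ultimately have "{B'. \<exists>A'. (A', B') \<in> f \<and> A' \<subseteq> A} = {B}" using AB by blast
  then show ?thesis by simp
qed

text \<open>Domain blocks are pulled back along \<open>inv \<sigma>\<close>, that is, pushed forward
  along \<sigma>, and the codomain is untouched. Factoring through a shuffle thereby becomes an
  equation between graphs.\<close>

lemma graph_mult_perm_right:
  assumes \<sigma>: "\<sigma> permutes {1..degree f}"
  shows "graph (ubp_mult f (ubp_of_perm (degree f) (inv \<sigma>))) = map_blocks \<sigma> id (graph f)"
proof -
  let ?n = "degree f" and ?p = "ubp_of_perm (degree f) (inv \<sigma>)"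
  note rep = ubp_of_perm_rep[OF permutes_inv[OF \<sigma>]]
  have R: "Range (graph ?p) = (\<lambda>i. {i}) ` {1..?n}"
  proof -
    have "Range (graph ?p) = (\<lambda>i. {i}) ` inv \<sigma> ` {1..?n}"
      unfolding rep by (force simp: image_image)
    then show ?thesis using permutes_image[OF permutes_inv[OF \<sigma>]] by simp
  qed
  have pD: "partition_on {1..?n} (Domain (graph f))"
    using graph_between by (auto simp: is_ubp_between_def)
  have X: "\<Union>{A. \<exists>B. (A, B) \<in> graph ?p \<and> B \<subseteq> E} = \<sigma> ` E" if "E \<subseteq> {1..?n}" for E
  proof -
    have "{A. \<exists>B. (A, B) \<in> graph ?p \<and> B \<subseteq> E} = (\<lambda>i. {i}) ` {i \<in> {1..?n}. inv \<sigma> i \<in> E}"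
      unfolding rep image_def by auto
    moreover have "{i \<in> {1..?n}. inv \<sigma> i \<in> E} = \<sigma> ` E"
    proof (intro set_eqI iffI)
      fix x assume "x \<in> {i \<in> {1..?n}. inv \<sigma> i \<in> E}"
      then show "x \<in> \<sigma> ` E" using permutes_inverses(1)[OF \<sigma>] by (metis (lifting) image_eqI mem_Collect_eq)
    next
      fix x assume "x \<in> \<sigma> ` E"
      then show "x \<in> {i \<in> {1..?n}. inv \<sigma> i \<in> E}"
        using that permutes_inverses(2)[OF \<sigma>] permutes_in_image[OF \<sigma>] by (smt (verit) imageE mem_Collect_eq subsetD)
    qed
    ultimately show ?thesis by simp
  qed
  have "graph (ubp_mult f ?p) = mult_graph ?n (graph f) (graph ?p)"
    using ubp_mult_rep(1)[of f ?p] rep(2) by simp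
  also have "\<dots> = (\<lambda>E. (\<Union>{A. \<exists>B. (A, B) \<in> graph ?p \<and> B \<subseteq> E},
      \<Union>{D. \<exists>C. (C, D) \<in> graph f \<and> C \<subseteq> E})) ` Domain (graph f)"
    by (simp only: mult_graph_def R finest_join_singletons[OF pD])
  also have "\<dots> = (\<lambda>(A, B). (\<Union>{A'. \<exists>B. (A', B) \<in> graph ?p \<and> B \<subseteq> A},
      \<Union>{D. \<exists>C. (C, D) \<in> graph f \<and> C \<subseteq> A})) ` graph f"
    by (simp add: Domain_fst image_image case_prod_unfold)
  also have "\<dots> = map_blocks \<sigma> id (graph f)"
    unfolding map_blocks_def
  proof (rule image_cong[OF refl])
    fix x assume "x \<in> graph f"
    then obtain A B where x: "x = (A, B)" and AB: "(A, B) \<in> graph f" by (cases x) auto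
    show "(case x of (A, B) \<Rightarrow> (\<Union>{A'. \<exists>B. (A', B) \<in> graph ?p \<and> B \<subseteq> A},
        \<Union>{D. \<exists>C. (C, D) \<in> graph f \<and> C \<subseteq> A})) = (case x of (A, B) \<Rightarrow> (\<sigma> ` A, id ` B))"
      using X[OF is_ubp_between_blocks(1)[OF graph_between AB]] ubp_image_block[OF graph_between AB]
      by (simp add: x)
  qed
  finally show ?thesis .
qed

lemma degree_mult_perm_right:
  assumes "\<sigma> permutes {1..degree f}"
  shows "degree (ubp_mult f (ubp_of_perm (degree f) \<sigma>)) = degree f"
  using ubp_mult_rep(2)[of f] ubp_of_perm_rep(2)[OF assms] by simp

section \<open>Inversion as an anti-automorphism\<close>

text \<open>The defining condition of the join is symmetric in the two partitions, and the two
  unions in \<open>mult_graph\<close> trade places under converse.\<close>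

lemma mult_graph_converse:
  assumes "partition_on {1..n} (Range f)" "partition_on {1..n} (Domain g)"
  shows "(mult_graph n g f)\<inverse> = mult_graph n (f\<inverse>) (g\<inverse>)"
proof -
  have "finest_join {1..n} (Range f) (Domain g) = finest_join {1..n} (Domain g) (Range f)"
    unfolding finest_join_def by (rule arg_cong[where f = The]) blast
  then show ?thesis by (force simp: mult_graph_def)
qed

lemma ubp_inverse_mult:
  assumes "degree g = degree f"
  shows "ubp_inverse (ubp_mult g f) = ubp_mult (ubp_inverse f) (ubp_inverse g)"
proof (rule ubp_eqI)
  have "partition_on {1..degree f} (Range (graph f))" "partition_on {1..degree f} (Domain (graph g))"
    using graph_between[of f] graph_between[of g] assms by (auto simp: is_ubp_between_def)
  then show "graph (ubp_inverse (ubp_mult g f)) = graph (ubp_mult (ubp_inverse f) (ubp_inverse g))"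
    using assms mult_graph_converse by (simp add: ubp_inverse_rep ubp_mult_rep)
qed

lemma ubp_inverse_inverse [simp]: "ubp_inverse (ubp_inverse f) = f"
  by (rule ubp_eqI) (simp add: ubp_inverse_rep)

lemma degree_inverse [simp]: "degree (ubp_inverse f) = degree f"
  by (rule ubp_inverse_rep)

lemma ubp_inverse_eq_iff: "ubp_inverse f = g \<longleftrightarrow> f = ubp_inverse g"
  by auto

lemma ubp_inverse_empty [simp]: "ubp_inverse ubp_empty = ubp_empty"
  by (rule ubp_eqI) (simp add: ubp_inverse_rep ubp_empty_rep)

lemma ubp_inverse_perm:
  assumes \<sigma>: "\<sigma> permutes {1..n}"
  shows "ubp_inverse (ubp_of_perm n \<sigma>) = ubp_of_perm n (inv \<sigma>)"
proof (rule ubp_eqI)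
  have "((\<lambda>i. ({i}, {\<sigma> i})) ` {1..n})\<inverse> = (\<lambda>i. ({\<sigma> i}, {i})) ` {1..n}"
    by auto
  also have "\<dots> = (\<lambda>i. ({i}, {inv \<sigma> i})) ` \<sigma> ` {1..n}"
    using permutes_inverses[OF \<sigma>] by (auto simp: image_image)
  also have "\<sigma> ` {1..n} = {1..n}" by (rule permutes_image[OF \<sigma>])
  finally show "graph (ubp_inverse (ubp_of_perm n \<sigma>)) = graph (ubp_of_perm n (inv \<sigma>))"
    unfolding ubp_inverse_rep ubp_of_perm_rep[OF \<sigma>] ubp_of_perm_rep[OF permutes_inv[OF \<sigma>]]
    .
qed

lemma ubp_inverse_concat:
  "ubp_inverse (ubp_concat f g) = ubp_concat (ubp_inverse f) (ubp_inverse g)"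
  by (rule ubp_eqI)
    (simp add: ubp_inverse_rep ubp_concat_rep concat_graph_map_blocks converse_Un converse_map_blocks)


section \<open>Splittings\<close>

text \<open>Both ground sets are counted block by block, and matched blocks have equal size. This
  gives the domain of a lower half the size that a shuffle requires.\<close>

lemma is_ubp_between_card:
  assumes f: "is_ubp_between S T f" and fin: "finite S" "finite T"
  shows "card S = card T"
proof -
  have pt: "partition_on S (Domain f)" "partition_on T (Range f)"
    and sv: "single_valued f" "single_valued (f\<inverse>)"
    and crd: "\<And>A B. (A, B) \<in> f \<Longrightarrow> card A = card B"
    using f by (auto simp: is_ubp_between_def)
  have "finite A" if "A \<in> Domain f" for A
    using that is_ubp_between_blocks[OF f] fin by (meson DomainE finite_subset)
  moreover have inj: "inj_on fst f" "inj_on snd f"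
    using sv unfolding inj_on_def single_valued_def by (metis converse_iff prod.collapse)+
  ultimately have "card S = sum card (fst ` f)"
    using product_partition[OF pt(1)] by (simp add: Domain_fst)
  also have "\<dots> = (\<Sum>p\<in>f. card (fst p))"
    by (simp add: sum.reindex inj)
  also have "\<dots> = (\<Sum>p\<in>f. card (snd p))" using crd by (intro sum.cong) auto
  also have "\<dots> = sum card (snd ` f)"
    by (simp add: sum.reindex inj)
  also have "finite B" if "B \<in> Range f" for B
    using that is_ubp_between_blocks[OF f] fin by (meson RangeE finite_subset)
  then have "sum card (snd ` f) = card T"
    using product_partition[OF pt(2)] by (simp add: Range_snd)
  finally show ?thesis .
qed

section \<open>Shuffles and the images of their first runs\<close>

text \<open>Both functions carry the increasing list of \<open>A\<close> to the increasing list of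
  the common image, and a finite set has only one such list.\<close>

lemma strict_mono_on_image_unique:
  fixes f g :: "'a::linorder \<Rightarrow> 'b::linorder"
  assumes A: "finite A" and f: "strict_mono_on A f" and g: "strict_mono_on A g"
    and eq: "f ` A = g ` A" and x: "x \<in> A"
  shows "f x = g x"
proof -
  let ?xs = "sorted_list_of_set A"
  have sorted: "sorted_wrt (<) (map h ?xs)" if "strict_mono_on A h" for h :: "'a \<Rightarrow> 'b"
    unfolding sorted_wrt_map
    using strict_sorted_list_of_set[of A]
    by (rule sorted_wrt_mono_rel[rotated]) (use that A in \<open>auto simp: strict_mono_on_def\<close>)
  have "map f ?xs = map g ?xs"
    using sorted[OF g] sorted[OF f] by (rule strict_sorted_equal) (use A eq in simp)
  then show ?thesis using A x by simp
qed

text \<open>The image of the second run is the complement of the image of the first, so this one set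
  fixes the values on both runs; elsewhere a permutation of the interval is the identity.\<close>

lemma shuffle_unique:
  assumes \<xi>: "\<xi> \<in> shuffles_perm n m" and \<xi>': "\<xi>' \<in> shuffles_perm n m"
    and eq: "\<xi> ` {1..n} = \<xi>' ` {1..n}"
  shows "\<xi> = \<xi>'"
proof
  fix x
  have p: "\<xi> permutes {1..n + m}" "\<xi>' permutes {1..n + m}"
    using \<xi> \<xi>' by (simp_all add: shuffles_perm_def)
  have "{n + 1..n + m} = {1..n + m} - {1..n}" by auto
  then have "\<sigma> ` {n + 1..n + m} = {1..n + m} - \<sigma> ` {1..n}" if "\<sigma> permutes {1..n + m}" for \<sigma>
    using permutes_image[OF that] by (simp add: image_set_diff[OF permutes_inj[OF that]])
  then have eq': "\<xi> ` {n + 1..n + m} = \<xi>' ` {n + 1..n + m}" using p eq by metis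
  consider "x \<in> {1..n}" | "x \<in> {n + 1..n + m}" | "x \<notin> {1..n + m}" by force
  then show "\<xi> x = \<xi>' x"
  proof cases
    case 1
    then show ?thesis using \<xi> \<xi>' eq
      by (intro strict_mono_on_image_unique[of "{1..n}"]) (auto simp: shuffles_perm_def)
  next
    case 2
    then show ?thesis using \<xi> \<xi>' eq'
      by (intro strict_mono_on_image_unique[of "{n + 1..n + m}"]) (auto simp: shuffles_perm_def)
  next
    case 3
    then show ?thesis using p by (metis permutes_not_in)
  qed
qed

lemma shuffle_exists:
  assumes X: "X \<subseteq> {1..n + m}" "card X = n"
  obtains \<xi> where "\<xi> \<in> shuffles_perm n m" "\<xi> ` {1..n} = X"
proof -
  define Y where "Y = {1..n + m} - X"
  have fin: "finite X" "finite Y" using X finite_subset by (auto simp: Y_def)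
  have "card Y = m" using X fin by (simp add: Y_def card_Diff_subset)
  then obtain h k where h: "bij_betw h {..<n} X" "strict_mono_on {..<n} h"
    and k: "bij_betw k {..<m} Y" "strict_mono_on {..<m} k"
    using ex_bij_betw_strict_mono_card[OF fin(1)] ex_bij_betw_strict_mono_card[OF fin(2)] X(2)
    by metis
  \<comment> \<open>The increasing enumerations \<open>h\<close> and \<open>k\<close> are indexed
    from 0, the two runs start at 1 and at n + 1. Outside the interval the value is
    \<open>x\<close>, as \<open>permutes\<close> demands.\<close>
  define \<xi> where "\<xi> = (\<lambda>x. if x \<in> {1..n} then h (x - 1)
    else if x \<in> {n + 1..n + m} then k (x - (n + 1)) else x)"
  have "bij_betw (\<lambda>x. x - 1) {1..n} {..<n}"
    by (rule bij_betwI[where g = "\<lambda>x. x + 1"]) auto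
  from bij_betw_trans[OF this h(1)] have 1: "bij_betw \<xi> {1..n} X"
    by (subst bij_betw_cong[of _ _ "h \<circ> (\<lambda>x. x - 1)"]) (auto simp: \<xi>_def)
  have "bij_betw (\<lambda>x. x - (n + 1)) {n + 1..n + m} {..<m}"
    by (rule bij_betwI[where g = "\<lambda>x. x + (n + 1)"]) auto
  from bij_betw_trans[OF this k(1)] have 2: "bij_betw \<xi> {n + 1..n + m} Y"
    by (subst bij_betw_cong[of _ _ "k \<circ> (\<lambda>x. x - (n + 1))"]) (auto simp: \<xi>_def)
  have "bij_betw \<xi> ({1..n} \<union> {n + 1..n + m}) (X \<union> Y)"
    using 1 2 by (rule bij_betw_combine) (auto simp: Y_def)
  moreover have "{1..n} \<union> {n + 1..n + m} = {1..n + m}" by auto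
  moreover have "X \<union> Y = {1..n + m}" using X by (auto simp: Y_def)
  ultimately have "\<xi> permutes {1..n + m}"
    by (intro bij_imp_permutes) (auto simp: \<xi>_def)
  moreover have "strict_mono_on {1..n} \<xi>"
    by (rule strict_mono_onI) (use strict_mono_onD[OF h(2)] in \<open>simp add: \<xi>_def\<close>)
  moreover have "strict_mono_on {n + 1..n + m} \<xi>"
    by (rule strict_mono_onI) (use strict_mono_onD[OF k(2)] in \<open>simp add: \<xi>_def\<close>)
  ultimately show thesis using 1 that by (auto simp: shuffles_perm_def bij_betw_def)
qed

lemma shuffles_perm_0_right: "\<xi> \<in> shuffles_perm n 0 \<longleftrightarrow> \<xi> = id"
proof
  assume \<xi>: "\<xi> \<in> shuffles_perm n 0"
  have id: "id \<in> shuffles_perm n 0" by (auto simp: shuffles_perm_def permutes_id strict_mono_on_def)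
  show "\<xi> = id"
    using \<xi> id by (rule shuffle_unique) (use \<xi> permutes_image in \<open>auto simp: shuffles_perm_def\<close>)
qed (auto simp: shuffles_perm_def permutes_id strict_mono_on_def)

lemma finite_shuffles_perm: "finite (shuffles_perm n m)"
  by (rule finite_subset[OF _ finite_permutations[of "{1..n + m}"]]) (auto simp: shuffles_perm_def)

section \<open>Factorisations at breaking points\<close>

text \<open>The degrees are read off \<open>f\<close> and \<open>g\<close> instead of a chosen
  breaking point, so that one relation serves the coproduct and, after inversion, the
  product.\<close>

definition splits_by :: "ubp \<Rightarrow> (nat \<Rightarrow> nat) \<Rightarrow> ubp \<Rightarrow> ubp \<Rightarrow> bool" where
  "splits_by h \<xi> f g \<longleftrightarrow> \<xi> \<in> shuffles_perm (degree f) (degree g) \<and>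
     h = ubp_mult (ubp_concat f g) (ubp_of_perm (degree f + degree g) (inv \<xi>))"

lemma splits_by_permutes: "splits_by h \<xi> f g \<Longrightarrow> \<xi> permutes {1..degree f + degree g}"
  by (simp add: splits_by_def shuffles_perm_def)

lemma splits_by_graph:
  "splits_by h \<xi> f g \<longleftrightarrow> \<xi> \<in> shuffles_perm (degree f) (degree g) \<and>
     graph h = map_blocks \<xi> id (concat_graph (degree f) (graph f) (graph g))"
  using graph_mult_perm_right[of \<xi> "ubp_concat f g"]
  by (auto simp: splits_by_def ubp_concat_rep shuffles_perm_def intro: ubp_eqI)

lemma splits_by_degree: "splits_by h \<xi> f g \<Longrightarrow> degree h = degree f + degree g"
  using degree_mult_perm_right[of "inv \<xi>" "ubp_concat f g"] permutes_inv[of \<xi>]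
  by (auto simp: splits_by_def ubp_concat_rep shuffles_perm_def)

text \<open>Blocks are nonempty, so every shifted codomain block has a point above \<open>n\<close>.
  The codomain blocks therefore tell the two factors apart.\<close>

lemma concat_graph_low:
  assumes f: "is_ubp n f" and g: "is_ubp m g"
  shows "{(A, B) \<in> concat_graph n f g. B \<subseteq> {1..n}} = f"
    "{(A, B) \<in> concat_graph n f g. \<not> B \<subseteq> {1..n}} = map_blocks (\<lambda>a. a + n) (\<lambda>a. a + n) g"
proof -
  have "B \<subseteq> {1..n}" if "(A, B) \<in> f" for A B
    using is_ubp_between_blocks[OF f[unfolded is_ubp_iff_between] that] by blast
  moreover have "\<not> B \<subseteq> {1..n}" if AB: "(A, B) \<in> map_blocks (\<lambda>a. a + n) (\<lambda>a. a + n) g" for A B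
  proof -
    obtain A' B' where "(A', B') \<in> g" and B: "B = (\<lambda>a. a + n) ` B'"
      using AB by (auto simp: map_blocks_def)
    then obtain b where "b \<in> B'" "b \<ge> 1"
      using is_ubp_between_blocks[OF g[unfolded is_ubp_iff_between]]
      by (metis all_not_in_conv atLeastAtMost_iff subsetD)
    then show ?thesis by (force simp: B)
  qed
  ultimately show "{(A, B) \<in> concat_graph n f g. B \<subseteq> {1..n}} = f"
    "{(A, B) \<in> concat_graph n f g. \<not> B \<subseteq> {1..n}} = map_blocks (\<lambda>a. a + n) (\<lambda>a. a + n) g"
    unfolding concat_graph_map_blocks by auto
qed

lemma concat_graph_inject:
  assumes "is_ubp n f" "is_ubp m g" "is_ubp n f'" "is_ubp m g'"
    and eq: "concat_graph n f g = concat_graph n f' g'"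
  shows "f = f'" "g = g'"
proof -
  show "f = f'"
    using concat_graph_low(1)[OF assms(1,2)] concat_graph_low(1)[OF assms(3,4)] eq by simp
  have "map_blocks (\<lambda>a. a + n) (\<lambda>a. a + n) g = map_blocks (\<lambda>a. a + n) (\<lambda>a. a + n) g'"
    using concat_graph_low(2)[OF assms(1,2)] concat_graph_low(2)[OF assms(3,4)] eq by simp
  then show "g = g'"
    using assms by (intro map_blocks_inject[of "{1..m}" "{1..m}" g g']) (auto simp: is_ubp_iff_between)
qed

text \<open>The shuffle relabels only the domain, so the test on \<open>B\<close> selects the same
  pairs before and after it; before, these pairs form the graph of \<open>f\<close>. The right-hand
  side depends on \<open>h\<close> and the degree of \<open>f\<close> alone.\<close>

lemma splits_by_image:
  assumes "splits_by h \<xi> f g"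
  shows "\<xi> ` {1..degree f} = \<Union>(Domain {(A, B) \<in> graph h. B \<subseteq> {1..degree f}})"
proof -
  have "{(A, B) \<in> graph h. B \<subseteq> {1..degree f}} =
      map_blocks \<xi> id {(A, B) \<in> concat_graph (degree f) (graph f) (graph g). B \<subseteq> {1..degree f}}"
    using assms by (force simp: splits_by_graph map_blocks_def)
  also have "\<dots> = map_blocks \<xi> id (graph f)"
    by (simp only: concat_graph_low(1)[OF is_ubp_degree is_ubp_degree])
  also have "\<Union>(Domain \<dots>) = \<xi> ` \<Union>(Domain (graph f))"
    by (simp only: Domain_map_blocks image_Union)
  also have "\<Union>(Domain (graph f)) = {1..degree f}"
    using graph_between[of f] partition_onD1 by (metis is_ubp_between_def)
  finally show ?thesis by simp
qed

lemma splits_by_unique: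
  assumes 1: "splits_by h \<xi> f g" and 2: "splits_by h \<xi>' f' g'" and deg: "degree f = degree f'"
  shows "\<xi> = \<xi>' \<and> f = f' \<and> g = g'"
proof -
  have deg': "degree g = degree g'"
    using splits_by_degree[OF 1] splits_by_degree[OF 2] deg by simp
  have \<xi>: "\<xi> = \<xi>'"
  proof (rule shuffle_unique)
    show "\<xi> ` {1..degree f} = \<xi>' ` {1..degree f}"
      using splits_by_image[OF 1] splits_by_image[OF 2] deg by simp
  qed (use 1 2 deg deg' in \<open>auto simp: splits_by_def\<close>)
  let ?c = "concat_graph (degree f) (graph f) (graph g)"
  let ?c' = "concat_graph (degree f) (graph f') (graph g')"
  have ubp: "is_ubp (degree f) (graph f)" "is_ubp (degree g) (graph g)"
    "is_ubp (degree f) (graph f')" "is_ubp (degree g) (graph g')"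
    using is_ubp_degree deg deg' by metis+
  have "?c = ?c'"
  proof (rule map_blocks_inject)
    show "map_blocks \<xi> id ?c = map_blocks \<xi> id ?c'"
      using 1 2 \<xi> deg by (simp add: splits_by_graph)
    show "is_ubp_between {1..degree f + degree g} {1..degree f + degree g} ?c"
      "is_ubp_between {1..degree f + degree g} {1..degree f + degree g} ?c'"
      unfolding is_ubp_iff_between[symmetric] using is_ubp_concat ubp by blast+
    show "inj_on \<xi> {1..degree f + degree g}"
      using permutes_inj_on[OF splits_by_permutes[OF 1]] .
  qed simp
  from concat_graph_inject[OF ubp this] \<xi> show ?thesis by (auto intro: ubp_eqI)
qed

lemma splits_by_breaking_point:
  assumes "splits_by h \<xi> f g"
  shows "degree f \<in> breaking_points h"
proof -
  have "Range (graph f) \<subseteq> Range (graph h)"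
    using assms unfolding splits_by_graph concat_graph_map_blocks map_blocks_def by force
  moreover have "{1..degree f} = \<Union>(Range (graph f))"
    using graph_between[of f] partition_onD1 by (metis is_ubp_between_def)
  ultimately show ?thesis
    using splits_by_degree[OF assms] unfolding breaking_points_def by auto
qed

text \<open>The graph of \<open>h\<close> is cut according to codomain blocks. The lower pairs cover
  {1..i} in the codomain and a set \<open>X\<close> of i points in the domain; the shuffle with
  first image \<open>X\<close> standardises the domains of both halves.\<close>

lemma breaking_point_splits_by:
  assumes i: "i \<in> breaking_points h"
  obtains \<xi> f g where "degree f = i" "splits_by h \<xi> f g"
proof -
  let ?n = "degree h"
  obtain C where "i \<le> ?n" and C: "C \<subseteq> Range (graph h)" "{1..i} = \<Union>C"
    using i by (auto simp: breaking_points_def)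
  define m where "m = ?n - i"
  have n: "?n = i + m" using \<open>i \<le> ?n\<close> by (simp add: m_def)
  note ubp = graph_between[of h]
  have pD: "partition_on {1..?n} (Domain (graph h))" and pR: "partition_on {1..?n} (Range (graph h))"
    and sv: "single_valued (graph h)"
    using ubp by (auto simp: is_ubp_between_def)
  define lo where "lo = {(A, B) \<in> graph h. B \<subseteq> {1..i}}"
  define hi where "hi = graph h - lo"
  define X where "X = \<Union>(Domain lo)"
  have split: "graph h = lo \<union> hi" by (auto simp: lo_def hi_def)
  \<comment> \<open>A codomain block outside \<open>C\<close> is disjoint from every member of
    \<open>C\<close>, hence from {1..i}: no block straddles the cut.\<close>
  have hi_R: "B \<inter> {1..i} = {}" if AB: "(A, B) \<in> hi" for A B
  proof -
    have B: "B \<in> Range (graph h)" "B \<notin> C" using AB C by (auto simp: hi_def lo_def)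
    then have "B \<inter> B' = {}" if "B' \<in> C" for B'
      using disjointD[OF partition_onD2[OF pR], of B B'] B that C(1) by blast
    then show ?thesis unfolding C(2) by blast
  qed
  have R_lo: "\<Union>(Range lo) = {1..i}"
  proof
    show "{1..i} \<subseteq> \<Union>(Range lo)"
      using C unfolding lo_def by auto (metis C(2) RangeE Sup_upper UnionE atLeastAtMost_iff One_nat_def subsetD)
  qed (auto simp: lo_def)
  have "\<Union>(Range lo) \<union> \<Union>(Range hi) = {1..?n}"
    using partition_onD1[OF pR] split by auto
  then have R_hi: "\<Union>(Range hi) = {1..?n} - {1..i}"
    using R_lo hi_R by blast
  have "X \<union> \<Union>(Domain hi) = {1..?n}"
    using partition_onD1[OF pD] split by (auto simp: X_def)
  moreover have "A \<inter> A' = {}" if AB: "(A, B) \<in> lo" and AB': "(A', B') \<in> hi" for A B A' B'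
  proof -
    have "A \<noteq> A'" using AB AB' sv by (auto simp: lo_def hi_def single_valued_def)
    moreover have "A \<in> Domain (graph h)" "A' \<in> Domain (graph h)" using AB AB' split by auto
    ultimately show ?thesis using partition_onD2[OF pD] by (meson disjointD)
  qed
  then have "X \<inter> \<Union>(Domain hi) = {}" unfolding X_def by blast
  ultimately have D_hi: "\<Union>(Domain hi) = {1..?n} - X" and X: "X \<subseteq> {1..?n}" by blast+
  have lo: "is_ubp_between X {1..i} lo"
    using is_ubp_between_restrict[OF ubp, of lo] split by (simp add: X_def R_lo)
  have hi: "is_ubp_between ({1..?n} - X) {i + 1..?n} hi"
  proof -
    have "{1..?n} - {1..i} = {i + 1..?n}" by auto
    then show ?thesis using is_ubp_between_restrict[OF ubp, of hi] split by (simp add: D_hi R_hi)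
  qed
  have "card X = i" using is_ubp_between_card[OF lo] X finite_subset by fastforce
  then obtain \<xi> where \<xi>: "\<xi> \<in> shuffles_perm i m" "\<xi> ` {1..i} = X"
    using shuffle_exists[of X i m] X n by metis
  have perm: "\<xi> permutes {1..?n}" using \<xi>(1) by (simp add: shuffles_perm_def n)
  have inv_X: "inv \<xi> ` X = {1..i}"
    using \<xi>(2) by (simp add: image_image permutes_inverses[OF perm] flip: \<xi>(2))
  have "{1..?n} - {1..i} = {i + 1..?n}" by auto
  then have inv_Y: "inv \<xi> ` ({1..?n} - X) = {i + 1..?n}"
    by (simp only: image_set_diff[OF permutes_inj[OF permutes_inv[OF perm]]] inv_X
        permutes_image[OF permutes_inv[OF perm]])
  define f where "f = map_blocks (inv \<xi>) id lo"
  \<comment> \<open>The subtraction is truncated, but \<open>inv \<xi>\<close> sends the upper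
    domain points above i, and the upper codomain blocks already lie there.\<close>
  define g where "g = map_blocks (\<lambda>a. inv \<xi> a - i) (\<lambda>a. a - i) hi"
  have inj: "inj_on (inv \<xi>) S" for S
    using permutes_inj[OF permutes_inv[OF perm]] inj_on_subset by blast
  have "is_ubp_between (inv \<xi> ` X) (id ` {1..i}) f"
    unfolding f_def by (rule is_ubp_between_map_blocks[OF lo inj]) simp
  then have f: "is_ubp i f" by (simp add: inv_X is_ubp_iff_between)
  have shift: "inj_on (\<lambda>a. a - i) {i + 1..?n}" "(\<lambda>a. a - i) ` {i + 1..?n} = {1..m}"
  proof -
    show "inj_on (\<lambda>a. a - i) {i + 1..?n}" by (auto simp: inj_on_def)
    have "x \<in> (\<lambda>a. a - i) ` {i + 1..?n}" if "x \<in> {1..m}" for x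
      by (rule image_eqI[of _ _ "x + i"]) (use that n in auto)
    then show "(\<lambda>a. a - i) ` {i + 1..?n} = {1..m}" using n by auto
  qed
  have "is_ubp_between ((\<lambda>a. a - i) ` inv \<xi> ` ({1..?n} - X)) ((\<lambda>a. a - i) ` {i + 1..?n}) g"
    unfolding g_def image_image
  proof (rule is_ubp_between_map_blocks[OF hi, of "\<lambda>a. inv \<xi> a - i", OF _ shift(1)])
    show "inj_on (\<lambda>a. inv \<xi> a - i) ({1..?n} - X)"
      using comp_inj_on[OF inj, of "\<lambda>a. a - i"] shift(1) inv_Y by (simp add: comp_def)
  qed
  then have g: "is_ubp m g" by (simp only: inv_Y shift is_ubp_iff_between)
  have "map_blocks \<xi> id (concat_graph i f g) = lo \<union> hi"
  proof -
    have "map_blocks \<xi> id f = lo"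
      unfolding f_def map_blocks_map_blocks permutes_inv_o[OF perm] by simp
    \<comment> \<open>Adding i undoes the truncated subtraction only from i upwards, so the
      composites are compared with the identity on the ground sets of \<open>hi\<close>
      only.\<close>
    moreover have "map_blocks \<xi> id (map_blocks (\<lambda>a. a + i) (\<lambda>a. a + i) g) = map_blocks id id hi"
      unfolding g_def map_blocks_map_blocks
    proof (rule map_blocks_cong[OF hi])
      fix x assume "x \<in> {1..?n} - X"
      then have "inv \<xi> x \<in> {i + 1..?n}" using inv_Y by blast
      then show "(\<xi> \<circ> ((\<lambda>a. a + i) \<circ> (\<lambda>a. inv \<xi> a - i))) x = id x"
        using permutes_inverses(1)[OF perm] by simp
    qed auto
    ultimately show ?thesis by (simp add: concat_graph_map_blocks map_blocks_Un)
  qed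
  then have "splits_by h \<xi> (Abs_ubp f) (Abs_ubp g)"
    using \<xi>(1) split by (simp add: splits_by_graph graph_Abs_ubp[OF f] graph_Abs_ubp[OF g])
  then show thesis using that graph_Abs_ubp(2)[OF f] by blast
qed

lemma splitting_eq_iff:
  assumes i: "i \<in> breaking_points h"
  shows "splitting h i = (\<xi>, f, g) \<longleftrightarrow> degree f = i \<and> splits_by h \<xi> f g"
proof -
  have eq: "(\<xi> \<in> shuffles_perm i (degree h - i) \<and> degree f = i \<and> degree g = degree h - i \<and>
      h = ubp_mult (ubp_concat f g) (ubp_of_perm (degree h) (inv \<xi>)))
    \<longleftrightarrow> degree f = i \<and> splits_by h \<xi> f g" for \<xi> f g
  proof -
    \<comment> \<open>This and the bound on i make the natural subtraction in
      \<open>splitting\<close> exact.\<close>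
    have "degree h = i + degree g" if "degree f = i" "splits_by h \<xi> f g"
      using splits_by_degree[OF that(2)] that(1) by simp
    moreover have "i \<le> degree h" using i by (simp add: breaking_points_def)
    ultimately show ?thesis by (auto simp: splits_by_def)
  qed
  have def: "splitting h i = (THE (\<xi>, f, g). degree f = i \<and> splits_by h \<xi> f g)"
    unfolding splitting_def eq ..
  obtain \<xi>' f' g' where 1: "degree f' = i" "splits_by h \<xi>' f' g'"
    using breaking_point_splits_by[OF i] .
  have "splitting h i = (\<xi>', f', g')"
    unfolding def
    by (rule the_equality) (use 1 splits_by_unique in \<open>auto simp: split_paired_all\<close>)
  then show ?thesis using 1 splits_by_unique[of h] by auto
qed

lemma snd_splitting_eq_iff:
  assumes "i \<in> breaking_points h"
  shows "snd (splitting h i) = (f, g) \<longleftrightarrow> degree f = i \<and> (\<exists>\<xi>. splits_by h \<xi> f g)"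
  using splitting_eq_iff[OF assms] by (metis prod.collapse snd_conv)

text \<open>Inverting the equation reverses the product and turns \<xi> into
  \<open>inv \<xi>\<close>, while the shuffle set depends only on degrees, which inversion keeps.
  Here terms of the product become terms of the coproduct.\<close>

lemma splits_by_inverse_iff:
  "splits_by (ubp_inverse h) \<xi> (ubp_inverse f) (ubp_inverse g) \<longleftrightarrow>
     \<xi> \<in> shuffles_perm (degree f) (degree g) \<and>
     ubp_mult (ubp_of_perm (degree f + degree g) \<xi>) (ubp_concat f g) = h"
proof -
  have "ubp_inverse (ubp_mult (ubp_of_perm (degree f + degree g) \<xi>) (ubp_concat f g)) =
     ubp_mult (ubp_concat (ubp_inverse f) (ubp_inverse g)) (ubp_of_perm (degree f + degree g) (inv \<xi>))"
    if "\<xi> permutes {1..degree f + degree g}"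
    using that by (simp add: ubp_inverse_mult ubp_inverse_concat ubp_inverse_perm
        ubp_of_perm_rep ubp_concat_rep)
  then show ?thesis
    unfolding splits_by_def by (auto simp: shuffles_perm_def ubp_inverse_eq_iff)
qed

text \<open>The only shuffle with an empty second run is the identity. This yields the right unit
  law and the top term of the coproduct.\<close>

lemma splits_by_empty_right: "(\<exists>\<xi>. splits_by h \<xi> f ubp_empty) \<longleftrightarrow> f = h"
  by (auto simp: splits_by_graph ubp_empty_rep shuffles_perm_0_right concat_graph_def
      dest: ubp_eqI[OF sym])

text \<open>The graphs are subsets of one finite set. Combined with a degree bound, this gives
  functionals in the graded dual finite support on the basis.\<close>

lemma finite_ubp_degree: "finite {f. degree f = n}"
proof -
  have "graph ` {f. degree f = n} \<subseteq> Pow (Pow {1..n} \<times> Pow {1..n})"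
  proof (intro subsetI PowI, clarify)
    fix A B f assume "(A, B) \<in> graph f"
    then show "A \<in> Pow {1..degree f} \<and> B \<in> Pow {1..degree f}"
      using is_ubp_between_blocks[OF graph_between] by auto
  qed
  then have "finite (graph ` {f. degree f = n})" by (rule finite_subset) simp
  then show ?thesis by (rule finite_imageD) (simp add: inj_on_def graph_inject)
qed

section \<open>Free modules\<close>

lemma lookup_free_scale [simp]:
  "Poly_Mapping.lookup (free_scale c x) b = c * Poly_Mapping.lookup x b"
  by (simp add: free_scale_def Poly_Mapping.map.rep_eq when_def)

lemma lookup_basis: "Poly_Mapping.lookup (basis a) b = (if a = b then 1 else 0)"
  by (simp add: basis_def lookup_single when_def)

text \<open>Only an inclusion, because over the zero ring \<open>basis b\<close> is 0 and has empty
  support.\<close>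

lemma keys_basis_subset: "Poly_Mapping.keys (basis b) \<subseteq> {b}"
  by (simp add: basis_def)

lemma free_module_expand:
  "x = (\<Sum>b\<in>Poly_Mapping.keys x. free_scale (Poly_Mapping.lookup x b) (basis b))"
  by (rule poly_mapping_eqI)
    (simp add: lookup_sum lookup_basis if_distrib[of "\<lambda>y. _ * y"] in_keys_iff cong: if_cong)

lemma free_module_induct [case_names basis add]:
  assumes basis: "\<And>c b. P (free_scale c (basis b))"
    and add: "\<And>x y. P x \<Longrightarrow> P y \<Longrightarrow> P (x + y)"
  shows "P x"
proof -
  \<comment> \<open>The case of 0 is the basis case with coefficient 0, at any basis
    element.\<close>
  have "free_scale 0 (basis undefined) = 0" by (rule poly_mapping_eqI) simp
  with basis have P0: "P 0" by metis
  have "P (\<Sum>b\<in>K. free_scale (c b) (basis b))" if "finite K" for c K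
    using that by (induction K rule: finite_induct) (simp_all add: P0 basis add)
  then show ?thesis by (subst free_module_expand) simp
qed

text \<open>The function \<open>c\<close> may have infinite support; finiteness comes from
  \<open>x\<close>. The coordinates of \<open>linear_extension\<close> have this form, which reduces
  linear maps to functionals.\<close>

definition functional_extension ::
  "('b \<Rightarrow> 'k) \<Rightarrow> ('b \<Rightarrow>\<^sub>0 'k::{comm_ring, comm_monoid_mult}) \<Rightarrow> 'k" where
  "functional_extension c x = (\<Sum>b\<in>Poly_Mapping.keys x. Poly_Mapping.lookup x b * c b)"

text \<open>\<open>K\<close> must contain only the indices of nonzero products, so it may be taken
  from the support of either factor. This allows sums over different supports to be
  compared.\<close>

lemma functional_extension_superset:
  assumes "finite K" "\<And>b. Poly_Mapping.lookup x b * c b \<noteq> 0 \<Longrightarrow> b \<in> K"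
  shows "functional_extension c x = (\<Sum>b\<in>K. Poly_Mapping.lookup x b * c b)"
  unfolding functional_extension_def
  by (rule sum.mono_neutral_cong) (use assms in \<open>auto simp: in_keys_iff\<close>)

lemma lookup_linear_extension:
  "Poly_Mapping.lookup (linear_extension F x) d = functional_extension (\<lambda>b. Poly_Mapping.lookup (F b) d) x"
  by (simp add: linear_extension_def functional_extension_def lookup_sum)

lemma functional_extension_basis [simp]: "functional_extension c (basis b) = c b"
  by (subst functional_extension_superset[of "{b}"])
    (auto simp: lookup_basis split: if_splits)

lemma functional_extension_add:
  "functional_extension c (x + y) = functional_extension c x + functional_extension c y"
proof -
  let ?K = "Poly_Mapping.keys x \<union> Poly_Mapping.keys y"
  have "functional_extension c z = (\<Sum>b\<in>?K. Poly_Mapping.lookup z b * c b)"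
    if "Poly_Mapping.keys z \<subseteq> ?K" for z
    by (rule functional_extension_superset)
      (use that in \<open>auto simp: in_keys_iff subset_iff, metis mult_zero_left\<close>)
  then show ?thesis using Poly_Mapping.keys_add[of x y]
    by (simp add: lookup_add distrib_right sum.distrib)
qed

lemma functional_extension_scale: "functional_extension c (free_scale a x) = a * functional_extension c x"
  by (subst functional_extension_superset[of "Poly_Mapping.keys x"])
    (auto simp: functional_extension_def in_keys_iff sum_distrib_left mult.assoc)

section \<open>Linear and bilinear maps on free modules\<close>

definition linear_functional ::
  "(('b \<Rightarrow>\<^sub>0 'k::{comm_ring, comm_monoid_mult}) \<Rightarrow> 'k) \<Rightarrow> bool" where
  "linear_functional \<alpha> \<longleftrightarrow>
     (\<forall>x y. \<alpha> (x + y) = \<alpha> x + \<alpha> y) \<and> (\<forall>c x. \<alpha> (free_scale c x) = c * \<alpha> x)"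

definition linear_map ::
  "(('b \<Rightarrow>\<^sub>0 'k::{comm_ring, comm_monoid_mult}) \<Rightarrow> ('d \<Rightarrow>\<^sub>0 'k)) \<Rightarrow> bool" where
  "linear_map F \<longleftrightarrow>
     (\<forall>x y. F (x + y) = F x + F y) \<and> (\<forall>c x. F (free_scale c x) = free_scale c (F x))"

lemma linear_functional_extension [simp]: "linear_functional (functional_extension c)"
  by (simp add: linear_functional_def functional_extension_add functional_extension_scale)

lemma linear_functional_lookup [simp]: "linear_functional (\<lambda>x. Poly_Mapping.lookup x b)"
  by (simp add: linear_functional_def lookup_add)

lemma linear_functional_comp: "linear_functional \<alpha> \<Longrightarrow> linear_map F \<Longrightarrow> linear_functional (\<lambda>x. \<alpha> (F x))"
  by (simp add: linear_functional_def linear_map_def)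

lemma linear_functional_eqI:
  assumes "linear_functional \<alpha>" "linear_functional \<beta>" "\<And>b. \<alpha> (basis b) = \<beta> (basis b)"
  shows "\<alpha> = \<beta>"
proof
  show "\<alpha> x = \<beta> x" for x
    using assms by (induction x rule: free_module_induct) (simp_all add: linear_functional_def)
qed

lemma linear_functional_eq_extension:
  assumes "linear_functional \<alpha>"
  shows "\<alpha> = functional_extension (\<lambda>b. \<alpha> (basis b))"
  by (rule linear_functional_eqI) (use assms in simp_all)

lemma linear_map_eqI:
  assumes "linear_map F" "linear_map G" "\<And>b. F (basis b) = G (basis b)"
  shows "F = G"
proof
  show "F x = G x" for x
    using assms by (induction x rule: free_module_induct) (simp_all add: linear_map_def)
qed

lemma linear_map_iff_lookup:
  "linear_map F \<longleftrightarrow> (\<forall>d. linear_functional (\<lambda>x. Poly_Mapping.lookup (F x) d))"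
  by (auto simp: linear_map_def linear_functional_def poly_mapping_eq_iff fun_eq_iff lookup_add)

lemma linear_extension_linear [simp]: "linear_map (linear_extension F)"
  by (simp add: linear_map_iff_lookup lookup_linear_extension)

lemma linear_extension_basis [simp]: "linear_extension F (basis b) = F b"
  by (rule poly_mapping_eqI) (simp add: lookup_linear_extension)

lemma linear_map_add: "linear_map F \<Longrightarrow> F (x + y) = F x + F y"
  by (simp add: linear_map_def)

lemma linear_map_zero: "linear_map F \<Longrightarrow> F 0 = 0"
  by (metis add_cancel_left_left linear_map_def)

lemma linear_map_sum: "linear_map F \<Longrightarrow> F (sum g A) = (\<Sum>a\<in>A. F (g a))"
  by (induction A rule: infinite_finite_induct) (simp_all add: linear_map_zero linear_map_def)

lemma linear_map_ident [simp]: "linear_map (\<lambda>x. x)"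
  by (simp add: linear_map_def)

lemma linear_map_comp: "linear_map F \<Longrightarrow> linear_map G \<Longrightarrow> linear_map (\<lambda>x. F (G x))"
  by (simp add: linear_map_def)

definition bilinear_map where
  "bilinear_map \<beta> \<longleftrightarrow> (\<forall>y. linear_map (\<lambda>x. \<beta> x y)) \<and> (\<forall>x. linear_map (\<beta> x))"

lemma bilinear_extension_bilinear [simp]: "bilinear_map (bilinear_extension F)"
proof -
  have "linear_map (bilinear_extension F x)" for x
  proof -
    have "linear_functional (\<lambda>y. functional_extension (\<lambda>b. functional_extension (\<lambda>c. Poly_Mapping.lookup (F b c) d) y) x)" for d
      by (simp add: linear_functional_def functional_extension_add functional_extension_scale)
        (simp add: functional_extension_def distrib_left sum.distrib sum_distrib_left mult.left_commute)
    then show ?thesis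
      by (simp add: linear_map_iff_lookup bilinear_extension_def lookup_linear_extension)
  qed
  then show ?thesis
    unfolding bilinear_map_def by (simp add: bilinear_extension_def)
qed

lemma bilinear_extension_basis [simp]: "bilinear_extension F (basis b) (basis c) = F b c"
  by (simp add: bilinear_extension_def)

lemma lookup_bilinear_extension:
  "Poly_Mapping.lookup (bilinear_extension F x y) d =
    (\<Sum>b\<in>Poly_Mapping.keys x. \<Sum>c\<in>Poly_Mapping.keys y.
       Poly_Mapping.lookup x b * Poly_Mapping.lookup y c * Poly_Mapping.lookup (F b c) d)"
  by (simp add: bilinear_extension_def lookup_linear_extension functional_extension_def
      sum_distrib_left mult.assoc)

lemma bilinear_map_eqI:
  assumes F: "bilinear_map F" and G: "bilinear_map G"
    and eq: "\<And>b c. F (basis b) (basis c) = G (basis b) (basis c)"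
  shows "F = G"
proof -
  have "(\<lambda>x. F x (basis c)) = (\<lambda>x. G x (basis c))" for c
    by (rule linear_map_eqI) (use F G eq in \<open>simp_all add: bilinear_map_def\<close>)
  then have "F x (basis c) = G x (basis c)" for x c by metis
  then have "F x = G x" for x
    by (intro linear_map_eqI) (use F G in \<open>simp_all add: bilinear_map_def\<close>)
  then show ?thesis by blast
qed

definition free_tensor ::
  "('b \<Rightarrow>\<^sub>0 'k::{comm_ring, comm_monoid_mult}) \<Rightarrow> ('c \<Rightarrow>\<^sub>0 'k) \<Rightarrow> ('b \<times> 'c \<Rightarrow>\<^sub>0 'k)" where
  "free_tensor = bilinear_extension (\<lambda>f g. basis (f, g))"

lemma free_tensor_basis [simp]: "free_tensor (basis b) (basis c) = basis (b, c)"
  by (simp add: free_tensor_def)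

lemma linear_functional_zero: "linear_functional \<alpha> \<Longrightarrow> \<alpha> 0 = 0"
  by (metis add_cancel_left_left linear_functional_def)

text \<open>One argument at a time is fixed, and functionals in the other are compared on the
  basis.\<close>

lemma linear_functional_tensor:
  assumes \<theta>: "linear_functional \<theta>" and \<alpha>: "linear_functional \<alpha>" and \<beta>: "linear_functional \<beta>"
    and eq: "\<And>b c. \<theta> (basis (b, c)) = \<alpha> (basis b) * \<beta> (basis c)"
  shows "\<theta> (free_tensor x y) = \<alpha> x * \<beta> y"
proof -
  have bil: "linear_map (\<lambda>x. free_tensor x y)" "linear_map (free_tensor x)" for x y
    using bilinear_extension_bilinear[of "\<lambda>f g. basis (f, g)"]
    unfolding bilinear_map_def free_tensor_def by blast+
  have "(\<lambda>x. \<theta> (free_tensor x (basis c))) = (\<lambda>x. \<alpha> x * \<beta> (basis c))" for c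
    by (rule linear_functional_eqI[OF linear_functional_comp[OF \<theta> bil(1)]])
      (use \<alpha> eq in \<open>simp_all add: linear_functional_def distrib_right mult.assoc\<close>)
  then have "\<theta> (free_tensor x (basis c)) = \<alpha> x * \<beta> (basis c)" for c by metis
  then have "(\<lambda>y. \<theta> (free_tensor x y)) = (\<lambda>y. \<alpha> x * \<beta> y)"
    by (intro linear_functional_eqI[OF linear_functional_comp[OF \<theta> bil(2)]])
      (use \<beta> in \<open>simp_all add: linear_functional_def distrib_left mult.left_commute\<close>)
  then show ?thesis by metis
qed

lemma lookup_free_tensor:
  "Poly_Mapping.lookup (free_tensor x y) (b, c) = Poly_Mapping.lookup x b * Poly_Mapping.lookup y c"
  by (rule linear_functional_tensor) (auto simp: lookup_basis)

text \<open>Universal property of the tensor product of free modules: both sides are bilinear and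
  agree on pairs of basis elements.\<close>

lemma linear_extension_free_tensor:
  assumes \<beta>: "bilinear_map \<beta>"
  shows "linear_extension (\<lambda>(b, c). \<beta> (basis b) (basis c)) (free_tensor x y) = \<beta> x y"
proof -
  let ?L = "linear_extension (\<lambda>(b, c). \<beta> (basis b) (basis c))"
  have bil: "linear_map (\<lambda>x. free_tensor x y)" "linear_map (free_tensor x)" for x y
    using bilinear_extension_bilinear[of "\<lambda>f g. basis (f, g)"]
    unfolding bilinear_map_def free_tensor_def by blast+
  have "linear_map (\<lambda>x. ?L (free_tensor x y))" "linear_map (\<lambda>y. ?L (free_tensor x y))" for x y
    by (rule linear_map_comp[OF linear_extension_linear bil(1)]
        linear_map_comp[OF linear_extension_linear bil(2)])+
  then have "(\<lambda>x y. ?L (free_tensor x y)) = \<beta>"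
    by (intro bilinear_map_eqI[OF _ \<beta>]) (simp_all add: bilinear_map_def)
  then show ?thesis by metis
qed

section \<open>Tensor products\<close>

text \<open>These are the elements at which the description in \<open>tensor_lift\<close> has at
  least one candidate value.\<close>

definition tensor_space :: "('k, 'a::comm_monoid_add, 't::comm_monoid_add) graded_hopf \<Rightarrow> 't set" where
  "tensor_space H = {\<Sum>(a, b)\<leftarrow>ps. tensor H a b | ps. set ps \<subseteq> space_of H \<times> space_of H}"

lemma tensor_space_zero: "0 \<in> tensor_space H"
  unfolding tensor_space_def by (rule CollectI, rule exI[of _ "[]"]) simp

lemma tensor_space_tensor:
  "a \<in> space_of H \<Longrightarrow> b \<in> space_of H \<Longrightarrow> tensor H a b \<in> tensor_space H"
  unfolding tensor_space_def by (rule CollectI, rule exI[of _ "[(a, b)]"]) simp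

lemma tensor_space_add:
  assumes "t \<in> tensor_space H" "u \<in> tensor_space H"
  shows "t + u \<in> tensor_space H"
proof -
  obtain ps qs where "set ps \<subseteq> space_of H \<times> space_of H" "t = (\<Sum>(a, b)\<leftarrow>ps. tensor H a b)"
    "set qs \<subseteq> space_of H \<times> space_of H" "u = (\<Sum>(a, b)\<leftarrow>qs. tensor H a b)"
    using assms by (auto simp: tensor_space_def)
  then show ?thesis
    unfolding tensor_space_def by (intro CollectI exI[of _ "ps @ qs"]) simp
qed

lemma tensor_space_sum: "(\<And>i. i \<in> I \<Longrightarrow> t i \<in> tensor_space H) \<Longrightarrow> sum t I \<in> tensor_space H"
  by (induction I rule: infinite_finite_induct) (simp_all add: tensor_space_zero tensor_space_add)

text \<open>
  The graph of the induced map is described by an additive relation \<open>R\<close>, because on a dual the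
  induced map has no natural extension to all of the type that contains the tensor product.
\<close>

lemma tensor_lift_rel:
  assumes zero: "R 0 0" and add: "\<And>t u v w. R t v \<Longrightarrow> R u w \<Longrightarrow> R (t + u) (v + w)"
    and tens: "\<And>a b. a \<in> space_of H \<Longrightarrow> b \<in> space_of H \<Longrightarrow> R (tensor H a b) (\<beta> a b)"
    and unique: "\<And>t v w. R t v \<Longrightarrow> R t w \<Longrightarrow> v = w"
    and t: "t \<in> tensor_space H"
  shows "R t (tensor_lift H \<beta> t)"
proof -
  let ?P = "\<lambda>ps v. set ps \<subseteq> space_of H \<times> space_of H \<and>
    t = (\<Sum>(a, b)\<leftarrow>ps. tensor H a b) \<and> v = (\<Sum>(a, b)\<leftarrow>ps. \<beta> a b)"
  have rel: "R (\<Sum>(a, b)\<leftarrow>ps. tensor H a b) (\<Sum>(a, b)\<leftarrow>ps. \<beta> a b)"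
    if "set ps \<subseteq> space_of H \<times> space_of H" for ps
    using that by (induction ps) (auto simp: zero intro!: add tens)
  obtain ps where ps: "set ps \<subseteq> space_of H \<times> space_of H" "t = (\<Sum>(a, b)\<leftarrow>ps. tensor H a b)"
    using t by (auto simp: tensor_space_def)
  have "tensor_lift H \<beta> t = (\<Sum>(a, b)\<leftarrow>ps. \<beta> a b)"
    unfolding tensor_lift_def
  proof (rule the_equality)
    show "\<exists>qs. ?P qs (\<Sum>(a, b)\<leftarrow>ps. \<beta> a b)" using ps by blast
    show "v = (\<Sum>(a, b)\<leftarrow>ps. \<beta> a b)" if "\<exists>qs. ?P qs v" for v
      using that rel ps unique by metis
  qed
  then show ?thesis using rel[OF ps(1)] ps(2) by simp
qed

section \<open>Structure constants\<close>

lemma finite_breaking_points: "finite (breaking_points f)"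
  by (rule finite_subset[of _ "{..degree f}"]) (auto simp: breaking_points_def)

text \<open>Only the breaking point i = \<open>degree f\<close> can produce \<open>f\<close> as
  first factor, so at most one term of the sum is nonzero.\<close>

lemma lookup_break_comult:
  "Poly_Mapping.lookup (break_comult h) (f, g) = (if \<exists>\<xi>. splits_by h \<xi> f g then 1 else 0)"
  (is "?l = _")
proof -
  have "?l =
      (\<Sum>i\<in>breaking_points h. if i = degree f then if \<exists>\<xi>. splits_by h \<xi> f g then 1 else 0 else 0)"
    unfolding break_comult_def lookup_sum lookup_basis
    by (intro sum.cong refl) (auto simp: snd_splitting_eq_iff)
  then show ?thesis
    using splits_by_breaking_point by (auto simp: finite_breaking_points split: if_splits)
qed

lemma shuffle_mult_eq_sum:
  "(shuffle_mult f g :: ubp \<Rightarrow>\<^sub>0 'k::{comm_ring, comm_monoid_mult}) = (\<Sum>\<xi>\<in>shuffles_perm (degree f) (degree g).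
     basis (ubp_mult (ubp_of_perm (degree f + degree g) \<xi>) (ubp_concat f g)))"
proof -
  have "linear_map (\<lambda>x. monoid_algebra_mult x y)" for y :: "ubp \<Rightarrow>\<^sub>0 'k"
    using bilinear_extension_bilinear by (auto simp: monoid_algebra_mult_def bilinear_map_def)
  note sum = linear_map_sum[OF this]
  show ?thesis
    unfolding shuffle_mult_def sh_def sum by (simp add: monoid_algebra_mult_def)
qed

text \<open>Uniqueness of splittings, applied to the inverses, leaves at most one contributing
  shuffle. Without multiplicities the coefficient has the same shape as that of the
  coproduct.\<close>

lemma lookup_shuffle_mult:
  "Poly_Mapping.lookup (shuffle_mult f g) h =
     (if \<exists>\<xi>. splits_by (ubp_inverse h) \<xi> (ubp_inverse f) (ubp_inverse g) then 1 else 0)"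
  (is "?l = _")
proof -
  let ?s = "\<lambda>\<xi>. splits_by (ubp_inverse h) \<xi> (ubp_inverse f) (ubp_inverse g)"
  have "?l = (\<Sum>\<xi>\<in>shuffles_perm (degree f) (degree g). if ?s \<xi> then 1 else 0)"
    unfolding shuffle_mult_eq_sum lookup_sum lookup_basis
    by (intro sum.cong refl) (auto simp: splits_by_inverse_iff)
  also have "\<dots> = (if \<exists>\<xi>. ?s \<xi> then 1 else 0)"
  proof (cases "\<exists>\<xi>. ?s \<xi>")
    case True
    then obtain \<xi> where \<xi>: "?s \<xi>" by blast
    then have "?s \<xi>' \<longleftrightarrow> \<xi>' = \<xi>" for \<xi>' using splits_by_unique by blast
    moreover have "\<xi> \<in> shuffles_perm (degree f) (degree g)"
      using \<xi> by (simp add: splits_by_inverse_iff)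
    ultimately show ?thesis by (simp add: finite_shuffles_perm)
  qed auto
  finally show ?thesis .
qed

text \<open>Both sides are indicators of the same existence statement. Read with \<open>f\<close>,
  \<open>g\<close> summed it gives the product of the dual, with \<open>h\<close> summed the
  coproduct.\<close>

lemma shuffle_mult_break_comult:
  "Poly_Mapping.lookup (shuffle_mult (ubp_inverse f) (ubp_inverse g)) h =
     Poly_Mapping.lookup (break_comult (ubp_inverse h)) (f, g)"
  by (simp add: lookup_shuffle_mult lookup_break_comult)

lemma shuffle_mult_empty_right: "shuffle_mult f ubp_empty = basis f"
  by (rule poly_mapping_eqI)
    (auto simp: lookup_shuffle_mult splits_by_empty_right lookup_basis ubp_inverse_eq_iff)

lemma break_comult_degree:
  assumes "Poly_Mapping.lookup (break_comult h) (f, g) \<noteq> 0"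
  shows "degree f + degree g = degree h"
  using assms splits_by_degree by (auto simp: lookup_break_comult split: if_splits)

section \<open>The dual\<close>

lemma fun_sum_apply: "sum f A x = (\<Sum>a\<in>A. f a x)"
  by (induction A rule: infinite_finite_induct) simp_all

lemma linear_functional_sum:
  assumes "\<And>i. i \<in> I \<Longrightarrow> linear_functional (\<alpha> i)"
  shows "linear_functional (sum \<alpha> I)"
  using assms by (simp add: linear_functional_def fun_sum_apply sum.distrib sum_distrib_left)

lemma ubp_hopf_sel:
  "component ubp_hopf n = {x. \<forall>f\<in>Poly_Mapping.keys x. degree f = n}"
  "scale ubp_hopf = free_scale" "mult ubp_hopf = bilinear_extension shuffle_mult"
  "unit ubp_hopf = basis ubp_empty" "tensor ubp_hopf = free_tensor"
  "comult ubp_hopf = linear_extension break_comult"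
  "counit ubp_hopf x = Poly_Mapping.lookup x ubp_empty"
  by (simp_all add: ubp_hopf_def free_tensor_def)

text \<open>Splits elements and, by composition, functionals into homogeneous pieces.\<close>

definition degree_part :: "nat \<Rightarrow> (ubp \<Rightarrow>\<^sub>0 'k::{comm_ring, comm_monoid_mult}) \<Rightarrow> (ubp \<Rightarrow>\<^sub>0 'k)" where
  "degree_part n = linear_extension (\<lambda>f. if degree f = n then basis f else 0)"

lemma lookup_degree_part:
  "Poly_Mapping.lookup (degree_part n x) f = (if degree f = n then Poly_Mapping.lookup x f else 0)"
proof -
  have "(\<lambda>x. Poly_Mapping.lookup (degree_part n x) f) =
      (\<lambda>x :: ubp \<Rightarrow>\<^sub>0 'a. if degree f = n then Poly_Mapping.lookup x f else 0)"
  proof (rule linear_functional_eqI)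
    show "linear_functional (\<lambda>x :: ubp \<Rightarrow>\<^sub>0 'a. Poly_Mapping.lookup (degree_part n x) f)"
      unfolding degree_part_def
      by (rule linear_functional_comp[OF linear_functional_lookup linear_extension_linear])
  qed (auto simp: degree_part_def lookup_basis linear_functional_def lookup_add)
  then show ?thesis by metis
qed

lemma space_of_ubp_hopf: "space_of ubp_hopf = (UNIV :: (ubp \<Rightarrow>\<^sub>0 'k::{comm_ring, comm_monoid_mult}) set)"
proof -
  have "x \<in> space_of ubp_hopf" for x :: "ubp \<Rightarrow>\<^sub>0 'k"
  proof -
    obtain N where N: "\<And>f. f \<in> Poly_Mapping.keys x \<Longrightarrow> degree f < N"
      using finite_nat_set_iff_bounded[of "degree ` Poly_Mapping.keys x"] by auto
    have "x = (\<Sum>n<N. degree_part n x)"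
      by (rule poly_mapping_eqI) (use N in \<open>auto simp: lookup_sum lookup_degree_part in_keys_iff\<close>)
    moreover have "degree_part n x \<in> component ubp_hopf n" for n
      by (auto simp: ubp_hopf_sel in_keys_iff lookup_degree_part split: if_splits)
    ultimately show ?thesis unfolding space_of_def by blast
  qed
  then show ?thesis by blast
qed

lemma tensor_space_ubp_hopf:
  "tensor_space ubp_hopf = (UNIV :: (ubp \<times> ubp \<Rightarrow>\<^sub>0 'k::{comm_ring, comm_monoid_mult}) set)"
proof -
  have "t \<in> tensor_space ubp_hopf" for t :: "ubp \<times> ubp \<Rightarrow>\<^sub>0 'k"
  proof (induction t rule: free_module_induct)
    case (basis c p)
    have "free_scale c (basis p) = free_tensor (free_scale c (basis (fst p))) (basis (snd p))"
      by (rule poly_mapping_eqI, case_tac k)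
        (auto simp: lookup_free_tensor lookup_basis prod_eq_iff)
    also have "\<dots> \<in> tensor_space ubp_hopf"
      using tensor_space_tensor[of _ "ubp_hopf :: ('k, _, _) graded_hopf"]
      by (simp add: space_of_ubp_hopf ubp_hopf_sel)
    finally show ?case .
  qed (rule tensor_space_add)
  then show ?thesis by blast
qed

text \<open>Every element of \<P> \<otimes> \<P> is a sum of pure tensors and the lift extends to
  the whole type, so the additive relation can be the graph of a function.\<close>

lemma tensor_lift_functional:
  assumes \<alpha>: "linear_functional \<alpha>" and \<beta>: "linear_functional \<beta>"
  shows "tensor_lift ubp_hopf (\<lambda>a b. \<alpha> a * \<beta> b) =
     functional_extension (\<lambda>(f, g). \<alpha> (basis f) * \<beta> (basis g))"
proof
  fix t
  let ?\<theta> = "functional_extension (\<lambda>(f, g). \<alpha> (basis f) * \<beta> (basis g))"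
  have \<theta>: "linear_functional ?\<theta>" by simp
  show "tensor_lift ubp_hopf (\<lambda>a b. \<alpha> a * \<beta> b) t = ?\<theta> t"
    by (rule tensor_lift_rel[of "\<lambda>t v. v = ?\<theta> t"])
      (use \<theta> linear_functional_tensor[OF \<theta> \<alpha> \<beta>] linear_functional_zero[OF \<theta>]
        in \<open>simp_all add: ubp_hopf_sel tensor_space_ubp_hopf linear_functional_def\<close>)
qed

lemma tensor_lift_bilinear:
  assumes \<beta>: "bilinear_map \<beta>"
  shows "tensor_lift ubp_hopf \<beta> = linear_extension (\<lambda>(f, g). \<beta> (basis f) (basis g))"
proof
  fix t
  let ?L = "linear_extension (\<lambda>(f, g). \<beta> (basis f) (basis g))"
  have L: "linear_map ?L" by simp
  show "tensor_lift ubp_hopf \<beta> t = ?L t"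
    by (rule tensor_lift_rel[of "\<lambda>t v. v = ?L t"])
      (use L linear_extension_free_tensor[OF \<beta>] linear_map_zero[OF L]
        in \<open>simp_all add: ubp_hopf_sel tensor_space_ubp_hopf linear_map_def\<close>)
qed

section \<open>Structure maps of the graded dual\<close>

abbreviation ubp_dual ::
  "('k::{comm_ring, comm_monoid_mult}, (ubp \<Rightarrow>\<^sub>0 'k) \<Rightarrow> 'k, (ubp \<times> ubp \<Rightarrow>\<^sub>0 'k) \<Rightarrow> 'k) graded_hopf" where
  "ubp_dual \<equiv> graded_dual ubp_hopf"

lemma component_dual:
  "component ubp_dual n =
     {\<alpha>. linear_functional \<alpha> \<and> (\<forall>f. degree f \<noteq> n \<longrightarrow> \<alpha> (basis f) = 0)}"
proof -
  have "(\<forall>m. m \<noteq> n \<longrightarrow> (\<forall>x\<in>component ubp_hopf m. \<alpha> x = 0)) \<longleftrightarrow>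
      (\<forall>f. degree f \<noteq> n \<longrightarrow> \<alpha> (basis f) = 0)"
    if \<alpha>: "linear_functional \<alpha>" for \<alpha> :: "(ubp \<Rightarrow>\<^sub>0 'k::{comm_ring, comm_monoid_mult}) \<Rightarrow> 'k"
  proof safe
    fix f :: ubp
    assume "\<forall>m. m \<noteq> n \<longrightarrow> (\<forall>x\<in>component ubp_hopf m. \<alpha> x = 0)" "degree f \<noteq> n"
    moreover have "basis f \<in> component ubp_hopf (degree f)"
      using keys_basis_subset[of f] by (auto simp: ubp_hopf_sel)
    ultimately show "\<alpha> (basis f) = 0" by blast
  next
    fix m and x :: "ubp \<Rightarrow>\<^sub>0 'k"
    assume "\<forall>f. degree f \<noteq> n \<longrightarrow> \<alpha> (basis f) = 0" "m \<noteq> n" "x \<in> component ubp_hopf m"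
    then show "\<alpha> x = 0"
      by (subst linear_functional_eq_extension[OF \<alpha>])
        (auto simp: functional_extension_def ubp_hopf_sel intro!: sum.neutral)
  qed
  then show ?thesis
    by (auto simp: graded_dual_def ubp_hopf_sel(2) linear_functional_def)
qed

text \<open>A finite sum of homogeneous functionals vanishes in large degrees. Conversely, the
  composites of \<alpha> with the projections below the bound add up to \<alpha>.\<close>

lemma space_of_dual:
  "\<alpha> \<in> space_of ubp_dual \<longleftrightarrow>
     linear_functional \<alpha> \<and> (\<exists>N. \<forall>f. N \<le> degree f \<longrightarrow> \<alpha> (basis f) = 0)"
  (is "_ \<longleftrightarrow> ?R \<alpha>")
proof
  assume "\<alpha> \<in> space_of ubp_dual"
  then obtain x N where \<alpha>: "\<alpha> = (\<Sum>n<N. x n)" and x: "\<And>n. x n \<in> component ubp_dual n"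
    by (auto simp: space_of_def)
  have "linear_functional (\<Sum>n<N. x n)"
    by (rule linear_functional_sum) (use x in \<open>simp add: component_dual\<close>)
  moreover have "\<alpha> (basis f) = 0" if "N \<le> degree f" for f
    using x that by (auto simp: \<alpha> fun_sum_apply component_dual intro!: sum.neutral)
  ultimately show "?R \<alpha>" using \<alpha> by blast
next
  assume "?R \<alpha>"
  then obtain N where \<alpha>: "linear_functional \<alpha>" and N: "\<And>f. N \<le> degree f \<Longrightarrow> \<alpha> (basis f) = 0"
    by blast
  define x where "x n = (\<lambda>y. \<alpha> (degree_part n y))" for n
  have x: "linear_functional (x n)" for n
    unfolding x_def degree_part_def by (rule linear_functional_comp[OF \<alpha> linear_extension_linear])
  have x_basis: "x n (basis f) = (if degree f = n then \<alpha> (basis f) else 0)" for n f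
    by (simp add: x_def degree_part_def linear_functional_zero[OF \<alpha>])
  have "\<alpha> = (\<Sum>n<N. x n)"
  proof (rule linear_functional_eqI[OF \<alpha>])
    show "linear_functional (\<Sum>n<N. x n)"
      by (rule linear_functional_sum) (rule x)
    show "\<alpha> (basis f) = (\<Sum>n<N. x n) (basis f)" for f
      using N[of f] by (auto simp: fun_sum_apply x_basis not_less[symmetric])
  qed
  moreover have "x n \<in> component ubp_dual n" for n
    using x x_basis by (simp add: component_dual)
  ultimately show "\<alpha> \<in> space_of ubp_dual" unfolding space_of_def by blast
qed

lemma dual_basis_in_space: "dual_basis f \<in> space_of ubp_dual"
  unfolding space_of_dual
  by (intro conjI exI[of _ "Suc (degree f)"]) (auto simp: dual_basis_def lookup_basis)

lemma scale_dual: "scale ubp_dual c \<alpha> = (\<lambda>x. c * \<alpha> x)"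
  by (simp add: graded_dual_def)

lemma unit_dual: "unit ubp_dual = dual_basis ubp_empty"
  by (simp add: graded_dual_def dual_basis_def ubp_hopf_sel fun_eq_iff)

lemma counit_dual: "counit ubp_dual \<alpha> = \<alpha> (basis ubp_empty)"
  by (simp add: graded_dual_def ubp_hopf_sel)

lemma tensor_dual:
  assumes "\<alpha> \<in> space_of ubp_dual" "\<beta> \<in> space_of ubp_dual"
  shows "tensor ubp_dual \<alpha> \<beta> = functional_extension (\<lambda>(f, g). \<alpha> (basis f) * \<beta> (basis g))"
proof -
  have "tensor ubp_dual \<alpha> \<beta> = tensor_lift ubp_hopf (\<lambda>a b. \<alpha> a * \<beta> b)"
    by (simp add: graded_dual_def)
  then show ?thesis using assms by (simp add: space_of_dual tensor_lift_functional)
qed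

lemma mult_dual:
  assumes "\<alpha> \<in> space_of ubp_dual" "\<beta> \<in> space_of ubp_dual"
  shows "mult ubp_dual \<alpha> \<beta> =
     (\<lambda>x. functional_extension (\<lambda>(f, g). \<alpha> (basis f) * \<beta> (basis g)) (linear_extension break_comult x))"
proof -
  have "mult ubp_dual \<alpha> \<beta> =
      (\<lambda>x. tensor_lift ubp_hopf (\<lambda>a b. \<alpha> a * \<beta> b) (linear_extension break_comult x))"
    by (simp add: graded_dual_def ubp_hopf_sel)
  then show ?thesis using assms by (simp add: space_of_dual tensor_lift_functional)
qed

lemma comult_dual:
  "comult ubp_dual \<alpha> = (\<lambda>t. \<alpha> (linear_extension (\<lambda>(f, g). shuffle_mult f g) t))"
  by (simp add: graded_dual_def tensor_lift_bilinear ubp_hopf_sel)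

text \<open>The coproduct preserves total degree, so beyond N + M one tensor factor lies beyond the
  bound of \<alpha> or of \<beta>.\<close>

lemma mult_dual_in_space:
  assumes \<alpha>: "\<alpha> \<in> space_of ubp_dual" and \<beta>: "\<beta> \<in> space_of ubp_dual"
  shows "mult ubp_dual \<alpha> \<beta> \<in> space_of ubp_dual"
proof -
  obtain N M where N: "\<And>f. N \<le> degree f \<Longrightarrow> \<alpha> (basis f) = 0"
    and M: "\<And>f. M \<le> degree f \<Longrightarrow> \<beta> (basis f) = 0"
    using \<alpha> \<beta> by (auto simp: space_of_dual)
  have "functional_extension (\<lambda>(f, g). \<alpha> (basis f) * \<beta> (basis g)) (break_comult h) = 0"
    if "N + M \<le> degree h" for h
    unfolding functional_extension_def
  proof (rule sum.neutral, clarify)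
    fix f g assume "(f, g) \<in> Poly_Mapping.keys (break_comult h :: _ \<Rightarrow>\<^sub>0 'a)"
    then have "degree f + degree g = degree h" using break_comult_degree by (auto simp: in_keys_iff)
    then have "N \<le> degree f \<or> M \<le> degree g" using that by linarith
    then show "Poly_Mapping.lookup (break_comult h) (f, g) * (\<alpha> (basis f) * \<beta> (basis g)) = 0"
      using N M by auto
  qed
  then have "\<forall>h. N + M \<le> degree h \<longrightarrow> mult ubp_dual \<alpha> \<beta> (basis h) = 0"
    by (simp add: mult_dual[OF \<alpha> \<beta>])
  moreover have "linear_functional (mult ubp_dual \<alpha> \<beta>)"
    unfolding mult_dual[OF \<alpha> \<beta>]
    by (rule linear_functional_comp[OF linear_functional_extension linear_extension_linear])
  ultimately show ?thesis unfolding space_of_dual by blast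
qed

lemma finite_ubp_degree_less: "finite {f. degree f < N}"
proof -
  have "{f. degree f < N} = (\<Union>n<N. {f. degree f = n})" by auto
  then show ?thesis by (simp add: finite_ubp_degree)
qed

text \<open>The bound makes \<theta> a finite combination of tensors of dual basis elements; an
  arbitrary functional on \<P> \<otimes> \<P> need not be one.\<close>

lemma tensor_space_dual:
  assumes \<theta>: "linear_functional \<theta>"
    and N: "\<And>f g. \<theta> (basis (f, g)) \<noteq> 0 \<Longrightarrow> degree f < N \<and> degree g < N"
  shows "\<theta> \<in> tensor_space ubp_dual"
proof -
  let ?F = "{f. degree f < N}"
  \<comment> \<open>The coefficient is absorbed into the first factor, since sums of pure tensors
    carry no scalars.\<close>
  let ?t = "\<lambda>(f, g). tensor ubp_dual (\<lambda>x. \<theta> (basis (f, g)) * dual_basis f x) (dual_basis g)"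
  have sp: "(\<lambda>x. c * dual_basis f x) \<in> space_of ubp_dual" for c f
    unfolding space_of_dual linear_functional_def
    by (intro conjI exI[of _ "Suc (degree f)"])
      (auto simp: dual_basis_def lookup_add lookup_basis distrib_left mult.left_commute)
  have t: "tensor ubp_dual (\<lambda>x. \<theta> (basis (f, g)) * dual_basis f x) (dual_basis g) =
      functional_extension (\<lambda>(f', g'). if f' = f \<and> g' = g then \<theta> (basis (f, g)) else 0)" for f g
    by (simp add: tensor_dual[OF sp dual_basis_in_space])
      (rule arg_cong[of _ _ functional_extension], auto simp: dual_basis_def lookup_basis)
  have "\<theta> = (\<Sum>p\<in>?F \<times> ?F. ?t p)"
  proof (rule linear_functional_eqI[OF \<theta>])
    show "linear_functional (\<Sum>p\<in>?F \<times> ?F. ?t p)"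
      by (rule linear_functional_sum) (auto simp: t)
    show "\<theta> (basis p) = (\<Sum>p\<in>?F \<times> ?F. ?t p) (basis p)" for p
    proof (cases p)
      case (Pair f g)
      have "(\<Sum>p\<in>?F \<times> ?F. ?t p) (basis p) = (\<Sum>q\<in>?F \<times> ?F. if q = (f, g) then \<theta> (basis (f, g)) else 0)"
        unfolding fun_sum_apply by (intro sum.cong refl) (auto simp: t Pair split: if_splits)
      then show ?thesis using N[of f g] by (auto simp: Pair finite_ubp_degree_less)
    qed
  qed
  also have "\<dots> \<in> tensor_space ubp_dual"
    by (rule tensor_space_sum) (auto intro!: tensor_space_tensor sp dual_basis_in_space)
  finally show ?thesis .
qed

text \<open>The product preserves degree, so a nonzero value at a pair forces the sum of the two
  degrees below the bound of \<alpha>, and with it each of them.\<close>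

lemma comult_dual_in_tensor_space:
  assumes \<alpha>: "\<alpha> \<in> space_of ubp_dual"
  shows "comult ubp_dual \<alpha> \<in> tensor_space ubp_dual"
proof -
  obtain N where lin: "linear_functional \<alpha>" and N: "\<And>f. N \<le> degree f \<Longrightarrow> \<alpha> (basis f) = 0"
    using \<alpha> by (auto simp: space_of_dual)
  have "\<alpha> (shuffle_mult f g) = 0" if fg: "N \<le> degree f + degree g" for f g
  proof -
    have "Poly_Mapping.lookup (shuffle_mult f g) h * \<alpha> (basis h) = 0" for h
    proof (cases "degree h = degree f + degree g")
      case False
      then show ?thesis using splits_by_degree[of "ubp_inverse h"] by (auto simp: lookup_shuffle_mult)
    qed (use N fg in simp)
    then show ?thesis
      by (subst linear_functional_eq_extension[OF lin]) (simp add: functional_extension_def)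
  qed
  then have "\<alpha> (shuffle_mult f g) \<noteq> 0 \<Longrightarrow> degree f < N \<and> degree g < N" for f g
    by (meson add_lessD1 not_le trans_less_add2 less_add_same_cancel1 le_add1 le_add2 order_trans)
  then show ?thesis
    unfolding comult_dual
    by (intro tensor_space_dual linear_functional_comp[OF lin linear_extension_linear]) auto
qed

section \<open>The isomorphism\<close>

text \<open>Unspecified on functionals that are nonzero on infinitely many basis elements.\<close>

definition from_dual :: "((ubp \<Rightarrow>\<^sub>0 'k::{comm_ring, comm_monoid_mult}) \<Rightarrow> 'k) \<Rightarrow> (ubp \<Rightarrow>\<^sub>0 'k)" where
  "from_dual \<alpha> = Poly_Mapping.Abs_poly_mapping (\<lambda>f. \<alpha> (basis (ubp_inverse f)))"

definition to_dual :: "(ubp \<Rightarrow>\<^sub>0 'k::{comm_ring, comm_monoid_mult}) \<Rightarrow> ((ubp \<Rightarrow>\<^sub>0 'k) \<Rightarrow> 'k)" where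
  "to_dual x = functional_extension (\<lambda>f. Poly_Mapping.lookup x (ubp_inverse f))"

text \<open>The degree bound, which inversion respects, leaves finitely many nonzero coefficients,
  so \<open>Abs_poly_mapping\<close> returns the given function.\<close>

lemma lookup_from_dual:
  assumes "\<alpha> \<in> space_of ubp_dual"
  shows "Poly_Mapping.lookup (from_dual \<alpha>) f = \<alpha> (basis (ubp_inverse f))"
proof -
  obtain N where "\<And>f. N \<le> degree f \<Longrightarrow> \<alpha> (basis f) = 0"
    using assms by (auto simp: space_of_dual)
  then have "{f. \<alpha> (basis (ubp_inverse f)) \<noteq> 0} \<subseteq> {f. degree f < N}"
    by (metis (mono_tags, lifting) degree_inverse linorder_not_less mem_Collect_eq subsetI)
  then have "finite {f. \<alpha> (basis (ubp_inverse f)) \<noteq> 0}"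
    using finite_ubp_degree_less finite_subset by blast
  then show ?thesis by (simp add: from_dual_def)
qed

lemma to_dual_in_space: "to_dual x \<in> space_of ubp_dual"
proof -
  obtain N where "\<And>f. f \<in> Poly_Mapping.keys x \<Longrightarrow> degree f < N"
    using finite_nat_set_iff_bounded[of "degree ` Poly_Mapping.keys x"] by auto
  then have "\<forall>f. N \<le> degree f \<longrightarrow> to_dual x (basis f) = 0"
    by (metis to_dual_def degree_inverse functional_extension_basis in_keys_iff linorder_not_less)
  then show ?thesis by (auto simp: space_of_dual to_dual_def)
qed

lemma from_dual_to_dual [simp]: "from_dual (to_dual x) = x"
  by (rule poly_mapping_eqI) (simp add: lookup_from_dual[OF to_dual_in_space], simp add: to_dual_def)

lemma to_dual_from_dual:
  assumes "\<alpha> \<in> space_of ubp_dual"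
  shows "to_dual (from_dual \<alpha>) = \<alpha>"
  by (rule linear_functional_eqI)
    (use assms in \<open>simp_all add: to_dual_def lookup_from_dual space_of_dual\<close>)

lemma to_dual_add: "to_dual (x + y) = to_dual x + to_dual y"
  by (rule ext) (simp add: to_dual_def lookup_add functional_extension_def distrib_left sum.distrib)

lemma from_dual_dual_basis: "from_dual (dual_basis f) = basis (ubp_inverse f)"
  unfolding poly_mapping_eq_iff fun_eq_iff lookup_from_dual[OF dual_basis_in_space]
  by (auto simp: dual_basis_def lookup_basis ubp_inverse_eq_iff)

text \<open>The sum is the image under \<open>to_dual\<close> of a sum in \<P>, so no common degree
  bound has to be found.\<close>

lemma add_in_space_dual:
  assumes "\<alpha> \<in> space_of ubp_dual" "\<beta> \<in> space_of ubp_dual"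
  shows "\<alpha> + \<beta> \<in> space_of ubp_dual"
  using to_dual_in_space[of "from_dual \<alpha> + from_dual \<beta>"] assms
  by (simp add: to_dual_add to_dual_from_dual)

lemma scale_in_space_dual: "\<alpha> \<in> space_of ubp_dual \<Longrightarrow> scale ubp_dual c \<alpha> \<in> space_of ubp_dual"
  unfolding scale_dual space_of_dual linear_functional_def
  by (metis (no_types, lifting) distrib_left mult.left_commute mult_zero_right)

lemma from_dual_add:
  assumes "\<alpha> \<in> space_of ubp_dual" "\<beta> \<in> space_of ubp_dual"
  shows "from_dual (\<alpha> + \<beta>) = from_dual \<alpha> + from_dual \<beta>"
  using assms by (intro poly_mapping_eqI) (simp add: lookup_add lookup_from_dual add_in_space_dual)

lemma from_dual_scale:
  assumes "\<alpha> \<in> space_of ubp_dual"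
  shows "from_dual (scale ubp_dual c \<alpha>) = free_scale c (from_dual \<alpha>)"
  using assms
  by (intro poly_mapping_eqI) (simp add: lookup_from_dual scale_in_space_dual, simp add: scale_dual)

lemma from_dual_mult:
  assumes \<alpha>: "\<alpha> \<in> space_of ubp_dual" and \<beta>: "\<beta> \<in> space_of ubp_dual"
  shows "from_dual (mult ubp_dual \<alpha> \<beta>) = bilinear_extension shuffle_mult (from_dual \<alpha>) (from_dual \<beta>)"
proof (rule poly_mapping_eqI)
  fix h
  let ?F = "Poly_Mapping.keys (from_dual \<alpha>)" and ?G = "Poly_Mapping.keys (from_dual \<beta>)"
  let ?i = "map_prod ubp_inverse ubp_inverse"
  have "Poly_Mapping.lookup (from_dual (mult ubp_dual \<alpha> \<beta>)) h =
      functional_extension (\<lambda>(f, g). \<alpha> (basis f) * \<beta> (basis g)) (break_comult (ubp_inverse h))"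
    by (simp add: lookup_from_dual mult_dual_in_space \<alpha> \<beta>, simp add: mult_dual \<alpha> \<beta>)
  \<comment> \<open>The support of the coproduct is replaced by the pairs at which \<alpha> and
    \<beta> can be nonzero. These are the inverses of the two transported supports, over which the
    product in \<P> is summed.\<close>
  also have "\<dots> = (\<Sum>p\<in>?i ` (?F \<times> ?G). Poly_Mapping.lookup (break_comult (ubp_inverse h)) p *
      (case p of (f, g) \<Rightarrow> \<alpha> (basis f) * \<beta> (basis g)))"
  proof (rule functional_extension_superset)
    fix p assume *: "Poly_Mapping.lookup (break_comult (ubp_inverse h)) p *
        (case p of (f, g) \<Rightarrow> \<alpha> (basis f) * \<beta> (basis g)) \<noteq> 0"
    obtain f g where p: "p = (f, g)" by (cases p)
    have "\<alpha> (basis f) \<noteq> 0" "\<beta> (basis g) \<noteq> 0" using * by (auto simp: p)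
    then have "(ubp_inverse f, ubp_inverse g) \<in> ?F \<times> ?G"
      by (simp add: in_keys_iff lookup_from_dual \<alpha> \<beta>)
    then show "p \<in> ?i ` (?F \<times> ?G)" by (rule image_eqI[rotated]) (simp add: p)
  qed simp
  also have "\<dots> = (\<Sum>(f, g)\<in>?F \<times> ?G.
      Poly_Mapping.lookup (from_dual \<alpha>) f * Poly_Mapping.lookup (from_dual \<beta>) g *
      Poly_Mapping.lookup (shuffle_mult f g) h)"
  proof (subst sum.reindex)
    show "inj_on ?i (?F \<times> ?G)" by (rule inj_onI) (auto simp: ubp_inverse_eq_iff)
  qed (auto intro!: sum.cong simp: lookup_from_dual \<alpha> \<beta> mult.commute
        shuffle_mult_break_comult[of "ubp_inverse f" "ubp_inverse g" for f g, simplified])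
  also have "\<dots> = Poly_Mapping.lookup (bilinear_extension shuffle_mult (from_dual \<alpha>) (from_dual \<beta>)) h"
    by (simp add: lookup_bilinear_extension sum.cartesian_product)
  finally show "Poly_Mapping.lookup (from_dual (mult ubp_dual \<alpha> \<beta>)) h =
    Poly_Mapping.lookup (bilinear_extension shuffle_mult (from_dual \<alpha>) (from_dual \<beta>)) h" .
qed

text \<open>The same structure constants as for the product, now with the pair fixed and the third
  index summed. The functional on the right is thus encoded by an element of \<P> \<otimes>
  \<P>.\<close>

lemma lookup_comult_from_dual:
  assumes \<alpha>: "\<alpha> \<in> space_of ubp_dual"
  shows "Poly_Mapping.lookup (linear_extension break_comult (from_dual \<alpha>)) (f, g) =
    comult ubp_dual \<alpha> (basis (ubp_inverse f, ubp_inverse g))"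
proof -
  let ?x = "shuffle_mult (ubp_inverse f) (ubp_inverse g) :: ubp \<Rightarrow>\<^sub>0 'a"
  let ?F = "Poly_Mapping.keys (from_dual \<alpha>)"
  have "comult ubp_dual \<alpha> (basis (ubp_inverse f, ubp_inverse g)) = \<alpha> ?x"
    by (simp add: comult_dual)
  also have "\<dots> = functional_extension (\<lambda>h. \<alpha> (basis h)) ?x"
    by (rule fun_cong[OF linear_functional_eq_extension]) (use \<alpha> in \<open>simp add: space_of_dual\<close>)
  also have "\<dots> = (\<Sum>h\<in>ubp_inverse ` ?F. Poly_Mapping.lookup ?x h * \<alpha> (basis h))"
  proof (rule functional_extension_superset)
    fix h assume "Poly_Mapping.lookup ?x h * \<alpha> (basis h) \<noteq> 0"
    then have "ubp_inverse h \<in> ?F" by (auto simp: in_keys_iff lookup_from_dual \<alpha>)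
    then show "h \<in> ubp_inverse ` ?F" by (rule image_eqI[rotated]) simp
  qed simp
  also have "\<dots> = (\<Sum>h\<in>?F. Poly_Mapping.lookup (from_dual \<alpha>) h * Poly_Mapping.lookup (break_comult h) (f, g))"
    by (subst sum.reindex)
      (auto intro!: inj_onI sum.cong simp: ubp_inverse_eq_iff lookup_from_dual \<alpha> mult.commute shuffle_mult_break_comult)
  finally show ?thesis
    by (simp add: lookup_linear_extension functional_extension_def)
qed

text \<open>A lift on the dual is computed by an additive map \<open>L\<close> on \<P> \<otimes>
  \<P>. The relation ties a functional to the element whose coefficients are its values at inverted
  basis pairs: such an element exists only for some functionals, but it is unique.\<close>

lemma tensor_lift_dual:
  fixes L :: "(ubp \<times> ubp \<Rightarrow>\<^sub>0 'k::{comm_ring, comm_monoid_mult}) \<Rightarrow> 'v::comm_monoid_add"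
  assumes zero: "L 0 = 0" and add: "\<And>p q. L (p + q) = L p + L q"
    and tens: "\<And>a b. a \<in> space_of ubp_dual \<Longrightarrow> b \<in> space_of ubp_dual \<Longrightarrow>
      L (free_tensor (from_dual a) (from_dual b)) = \<beta> a b"
    and \<alpha>: "\<alpha> \<in> space_of ubp_dual"
  shows "tensor_lift ubp_dual \<beta> (comult ubp_dual \<alpha>) = L (linear_extension break_comult (from_dual \<alpha>))"
proof -
  define R where "R t v \<longleftrightarrow> (\<exists>p. (\<forall>f g. Poly_Mapping.lookup p (f, g) =
    t (basis (ubp_inverse f, ubp_inverse g))) \<and> v = L p)" for t :: "(ubp \<times> ubp \<Rightarrow>\<^sub>0 'k) \<Rightarrow> 'k" and v
  have unique: "v = w" if "R t v" "R t w" for t v w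
  proof -
    obtain p q where *: "\<forall>f g. Poly_Mapping.lookup p (f, g) = t (basis (ubp_inverse f, ubp_inverse g))"
      "\<forall>f g. Poly_Mapping.lookup q (f, g) = t (basis (ubp_inverse f, ubp_inverse g))"
      "v = L p" "w = L q" using \<open>R t v\<close> \<open>R t w\<close> unfolding R_def by blast
    then have "p = q" by (intro poly_mapping_eqI) (metis surj_pair)
    then show ?thesis using * by simp
  qed
  have "R (comult ubp_dual \<alpha>) (tensor_lift ubp_dual \<beta> (comult ubp_dual \<alpha>))"
  proof (rule tensor_lift_rel[OF _ _ _ unique comult_dual_in_tensor_space[OF \<alpha>]])
    show "R 0 0" unfolding R_def by (rule exI[of _ 0]) (simp add: zero)
    show "R (t + u) (v + w)" if R: "R t v" "R u w" for t u v w
    proof -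
      obtain p q where "\<forall>f g. Poly_Mapping.lookup p (f, g) = t (basis (ubp_inverse f, ubp_inverse g))"
        "\<forall>f g. Poly_Mapping.lookup q (f, g) = u (basis (ubp_inverse f, ubp_inverse g))"
        "v = L p" "w = L q" using R unfolding R_def by blast
      then show ?thesis unfolding R_def by (intro exI[of _ "p + q"]) (simp add: lookup_add add)
    qed
    show "R (tensor ubp_dual a b) (\<beta> a b)" if "a \<in> space_of ubp_dual" "b \<in> space_of ubp_dual" for a b
      unfolding R_def using that
      by (intro exI[of _ "free_tensor (from_dual a) (from_dual b)"])
        (simp add: lookup_free_tensor lookup_from_dual tensor_dual tens)
  qed
  moreover have "R (comult ubp_dual \<alpha>) (L (linear_extension break_comult (from_dual \<alpha>)))"
    unfolding R_def using lookup_comult_from_dual[OF \<alpha>] by blast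
  ultimately show ?thesis by (rule unique)
qed

section \<open>Comparison of antipodes\<close>

text \<open>
  \<open>\<Delta>(h)\<close> is \<open>h \<otimes> \<emptyset>\<close> plus terms whose first factor has lower degree, so convolution with the
  identity determines \<open>S(h)\<close> recursively.
\<close>

lemma left_convolution_unique:
  fixes S T :: "(ubp \<Rightarrow>\<^sub>0 'k::{comm_ring, comm_monoid_mult}) \<Rightarrow> (ubp \<Rightarrow>\<^sub>0 'k)"
  assumes S: "linear_map S" and T: "linear_map T"
    and eq: "\<And>h. linear_extension (\<lambda>(f, g). bilinear_extension shuffle_mult (S (basis f)) (basis g)) (break_comult h) =
      linear_extension (\<lambda>(f, g). bilinear_extension shuffle_mult (T (basis f)) (basis g)) (break_comult h)"
  shows "S = T"
proof (rule linear_map_eqI[OF S T])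
  fix h :: ubp
  show "S (basis h) = T (basis h)"
  proof (induction "degree h" arbitrary: h rule: less_induct)
    case less
    let ?c = "\<lambda>S i. bilinear_extension shuffle_mult (S (basis (fst (snd (splitting h i))))) (basis (snd (snd (splitting h i))))"
    let ?B = "breaking_points h"
    have top: "degree h \<in> ?B" "snd (splitting h (degree h)) = (h, ubp_empty)"
    proof -
      obtain \<xi> where \<xi>: "splits_by h \<xi> h ubp_empty" using splits_by_empty_right by blast
      show *: "degree h \<in> ?B" using splits_by_breaking_point[OF \<xi>] .
      show "snd (splitting h (degree h)) = (h, ubp_empty)" using snd_splitting_eq_iff[OF *] \<xi> by blast
    qed
    have sum: "linear_extension (\<lambda>(f, g). bilinear_extension shuffle_mult (S (basis f)) (basis g)) (break_comult h)
        = ?c S (degree h) + (\<Sum>i\<in>?B - {degree h}. ?c S i)" for S :: "(ubp \<Rightarrow>\<^sub>0 'k) \<Rightarrow> (ubp \<Rightarrow>\<^sub>0 'k)"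
      unfolding break_comult_def linear_map_sum[OF linear_extension_linear] linear_extension_basis
      by (simp add: case_prod_unfold sum.remove[OF finite_breaking_points top(1)])
    have "(\<Sum>i\<in>?B - {degree h}. ?c S i) = (\<Sum>i\<in>?B - {degree h}. ?c T i)"
    proof (rule sum.cong[OF refl])
      fix i assume i: "i \<in> ?B - {degree h}"
      obtain f g where fg: "snd (splitting h i) = (f, g)" by fastforce
      then have "degree f = i" using i snd_splitting_eq_iff[of i h f g] by simp
      moreover have "i < degree h" using i by (auto simp: breaking_points_def)
      ultimately show "?c S i = ?c T i" using less[of f] by (simp add: fg)
    qed
    then have "?c S (degree h) = ?c T (degree h)" using eq[of h] by (simp add: sum)
    moreover have unit: "bilinear_extension shuffle_mult x (basis ubp_empty) = x" for x :: "ubp \<Rightarrow>\<^sub>0 'k"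
    proof -
      have "(\<lambda>x :: ubp \<Rightarrow>\<^sub>0 'k. bilinear_extension shuffle_mult x (basis ubp_empty)) = (\<lambda>x. x)"
        using bilinear_extension_bilinear[of "shuffle_mult :: _ \<Rightarrow> _ \<Rightarrow> (ubp \<Rightarrow>\<^sub>0 'k)"]
        by (intro linear_map_eqI) (simp_all add: bilinear_map_def shuffle_mult_empty_right)
      then show ?thesis by metis
    qed
    ultimately show ?case by (simp add: top)
  qed
qed

text \<open>\<open>U\<close> is the antipode of the dual transported to \<P>. Its left convolution
  with the identity agrees with that of \<open>T\<close>, so the two coincide.\<close>

lemma from_dual_antipode:
  fixes S :: "((ubp \<Rightarrow>\<^sub>0 'k::{comm_ring, comm_monoid_mult}) \<Rightarrow> 'k) \<Rightarrow> ((ubp \<Rightarrow>\<^sub>0 'k) \<Rightarrow> 'k)"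
  assumes S: "antipode ubp_dual S" and T: "antipode ubp_hopf T" and \<alpha>: "\<alpha> \<in> space_of ubp_dual"
  shows "from_dual (S \<alpha>) = T (from_dual \<alpha>)"
proof -
  define U where "U x = from_dual (S (to_dual x))" for x
  have S_space: "S a \<in> space_of ubp_dual" if "a \<in> space_of ubp_dual" for a
    using S that by (auto simp: antipode_def linear_between_def)
  have T_lin: "linear_map T"
    using T by (simp add: antipode_def linear_between_def linear_map_def space_of_ubp_hopf ubp_hopf_sel)
  have scale: "to_dual (free_scale c x) = scale ubp_dual c (to_dual x)" for c and x :: "ubp \<Rightarrow>\<^sub>0 'k"
    by (metis from_dual_scale from_dual_to_dual scale_in_space_dual to_dual_from_dual to_dual_in_space)
  have U_lin: "linear_map U"
    using S unfolding antipode_def linear_between_def linear_map_def U_def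
    by (simp add: to_dual_add scale to_dual_in_space S_space from_dual_add from_dual_scale)
  have bil: "bilinear_map (\<lambda>a b. bilinear_extension shuffle_mult (V a) b)"
    if "linear_map V" for V :: "(ubp \<Rightarrow>\<^sub>0 'k) \<Rightarrow> (ubp \<Rightarrow>\<^sub>0 'k)"
    using bilinear_extension_bilinear[of "shuffle_mult :: _ \<Rightarrow> _ \<Rightarrow> (ubp \<Rightarrow>\<^sub>0 'k)"] that
    by (simp add: bilinear_map_def linear_map_def)
  let ?conv = "\<lambda>V :: (ubp \<Rightarrow>\<^sub>0 'k) \<Rightarrow> (ubp \<Rightarrow>\<^sub>0 'k). linear_extension (\<lambda>(f, g). bilinear_extension shuffle_mult (V (basis f)) (basis g))"
  have conv_T: "?conv T (linear_extension break_comult x) = free_scale (Poly_Mapping.lookup x ubp_empty) (basis ubp_empty)" for x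
    using T tensor_lift_bilinear[OF bil[OF T_lin]]
    by (simp add: antipode_def space_of_ubp_hopf ubp_hopf_sel)
  have conv_U: "?conv U (linear_extension break_comult x) = free_scale (Poly_Mapping.lookup x ubp_empty) (basis ubp_empty)" for x
  proof -
    let ?a = "to_dual x"
    have a: "?a \<in> space_of ubp_dual" by (rule to_dual_in_space)
    have "tensor_lift ubp_dual (\<lambda>a b. mult ubp_dual (S a) b) (comult ubp_dual ?a) =
        to_dual (?conv U (linear_extension break_comult (from_dual ?a)))"
    \<comment> \<open>The lift takes values in the dual, so \<open>L\<close> is the convolution in
      \<P> followed by \<open>to_dual\<close>.\<close>
    proof (rule tensor_lift_dual[OF _ _ _ a, of "\<lambda>p. to_dual (?conv U p)"])
      show "to_dual (?conv U 0) = 0"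
        by (simp add: linear_map_zero[OF linear_extension_linear]) (simp add: to_dual_def functional_extension_def fun_eq_iff)
      show "to_dual (?conv U (p + q)) = to_dual (?conv U p) + to_dual (?conv U q)" for p q
        by (simp add: linear_map_add[OF linear_extension_linear] to_dual_add)
      show "to_dual (?conv U (free_tensor (from_dual a) (from_dual b))) = mult ubp_dual (S a) b"
        if "a \<in> space_of ubp_dual" "b \<in> space_of ubp_dual" for a b
        unfolding linear_extension_free_tensor[OF bil[OF U_lin]] using that
        by (simp add: U_def to_dual_from_dual mult_dual_in_space S_space flip: from_dual_mult)
    qed
    moreover have "tensor_lift ubp_dual (\<lambda>a b. mult ubp_dual (S a) b) (comult ubp_dual ?a) =
        scale ubp_dual (counit ubp_dual ?a) (unit ubp_dual)"
      using S a by (simp add: antipode_def)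
    ultimately have "to_dual (?conv U (linear_extension break_comult x)) =
        scale ubp_dual (counit ubp_dual ?a) (unit ubp_dual)" by simp
    then have "?conv U (linear_extension break_comult x) =
        from_dual (scale ubp_dual (counit ubp_dual ?a) (unit ubp_dual))" by (metis from_dual_to_dual)
    \<comment> \<open>Unit and counit correspond because the empty block permutation is its own
      inverse.\<close>
    also have "\<dots> = free_scale (Poly_Mapping.lookup x ubp_empty) (basis ubp_empty)"
      by (simp add: unit_dual from_dual_scale dual_basis_in_space from_dual_dual_basis counit_dual to_dual_def)
    finally show ?thesis .
  qed
  have "U = T"
  proof (rule left_convolution_unique[OF U_lin T_lin])
    show "?conv U (break_comult h) = ?conv T (break_comult h)" for h
      using conv_U[of "basis h"] conv_T[of "basis h"] by simp
  qed
  then show ?thesis using \<alpha> by (metis U_def to_dual_from_dual)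
qed

theorem proposition2p5:
  shows "\<exists>\<phi> :: ((ubp \<Rightarrow>\<^sub>0 'k::{comm_ring, comm_monoid_mult}) \<Rightarrow> 'k) \<Rightarrow> (ubp \<Rightarrow>\<^sub>0 'k).
           (\<forall>f. \<phi> (dual_basis f) = basis (ubp_inverse f)) \<and>
           graded_hopf_iso (graded_dual ubp_hopf) ubp_hopf \<phi>"
proof (intro exI conjI allI)
  let ?\<phi> = "from_dual :: ((ubp \<Rightarrow>\<^sub>0 'k) \<Rightarrow> 'k) \<Rightarrow> (ubp \<Rightarrow>\<^sub>0 'k)"
  show "?\<phi> (dual_basis f) = basis (ubp_inverse f)" for f by (rule from_dual_dual_basis)
  have "bij_betw ?\<phi> (space_of ubp_dual) (space_of ubp_hopf)"
    by (rule bij_betwI[where g = to_dual])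
      (auto simp: space_of_ubp_hopf to_dual_in_space to_dual_from_dual)
  moreover have "?\<phi> \<alpha> \<in> component ubp_hopf n" if \<alpha>: "\<alpha> \<in> component ubp_dual n" for n \<alpha>
  proof -
    have "\<alpha> \<in> space_of ubp_dual"
      using \<alpha> by (auto simp: component_dual space_of_dual intro!: exI[of _ "Suc n"])
    then show ?thesis
      using \<alpha> by (auto simp: ubp_hopf_sel in_keys_iff lookup_from_dual component_dual)
        (metis degree_inverse)
  qed
  \<comment> \<open>This is the case in which \<open>L\<close> is the identity of \<P> \<otimes>
    \<P>.\<close>
  moreover have "comult ubp_hopf (?\<phi> \<alpha>) =
      tensor_lift ubp_dual (\<lambda>a b. tensor ubp_hopf (?\<phi> a) (?\<phi> b)) (comult ubp_dual \<alpha>)"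
    if "\<alpha> \<in> space_of ubp_dual" for \<alpha>
    using tensor_lift_dual[of "\<lambda>p. p", OF _ _ _ that] by (simp add: ubp_hopf_sel)
  moreover have "linear_between ubp_dual ubp_hopf ?\<phi>"
    by (simp add: linear_between_def space_of_ubp_hopf ubp_hopf_sel from_dual_add from_dual_scale)
  ultimately show "graded_hopf_iso ubp_dual ubp_hopf ?\<phi>"
    unfolding graded_hopf_iso_def graded_hopf_hom_def
    by (auto simp: ubp_hopf_sel from_dual_mult unit_dual from_dual_dual_basis counit_dual
        lookup_from_dual from_dual_antipode)
qed

end
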